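(* Let $\varphi$ be a non-degenerate computable forecasting system and let $\omega\in\Omega$. Then $\omega$ is Schnorr random for $\varphi$ if and only if $\omega$ is Schnorr test random for $\varphi$.
   Context: Notation: $\mathbb N_0=\{0,1,2,\dots\}$; $\Omega=\{0,1\}^{\mathbb N}$ is the set of paths; $\mathbb S=\bigcup_{n\in\mathbb N_0}\{0,1\}^n$ the set of finite binary strings (situations), $\square$ the empty string, $|s|$ the length of $s$, $\omega^n$ the first $n$ entries of $\omega$ ($\omega^0=\square$), $sx$ concatenation. $[s]=\{\omega:\omega^{|s|}=s\}$, $[A]=\bigcup_{s\in A}[s]$. For $A\subseteq\mathbb N_0\times\mathbb S$: $A_n=\{s:(n,s)\in A\}$ and $A_n^{<\ell}=\{s\in A_n:|s|<\ell\}$. $\mathcal I$: nonempty closed subintervals of $[0,1]$; $\overline E_I(f)=\max_{p\in I}[pf(1)+(1-p)f(0)]$ for $f:\{0,1\}\to\mathbb R$. A forecasting system is $\varphi:\mathbb S\to\mathcal I$, with $\underline\varphi(s)=\min\varphi(s)$, $\overline\varphi(s)=\max\varphi(s)$; non-degenerate if $\underline\varphi(s)<1$ and $\overline\varphi(s)>0$ for all $s$. A supermartingale for $\varphi$ is $M:\mathbb S\to\mathbb R$ with $\overline E_{\varphi(s)}(M(s\,\cdot))\le M(s)$ for all $s$ ($M(s\,\cdot)$ is $x\mapsto M(sx)$); a test supermartingale is a non-negative one with $M(\square)=1$. For $G\subseteq\Omega$, $\overline P_\varphi(G)=\inf\{M(\square):M\text{ supermartingale for }\varphi,\ \liminf_nM(\omega^n)\ge\mathbb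 1_G(\omega)\ \forall\omega\}$. Computability: standard recursive maps/sets on encoded countable sets; a real map $r:\mathcal D\to\mathbb R$ is computable if there is a recursive $q:\mathcal D\times\mathbb N_0\to\mathbb Q$ with $|r(d)-q(d,N)|\le2^{-N}$; $\varphi$ is computable if $\underline\varphi,\overline\varphi$ are computable. A growth function is a recursive, non-decreasing, unbounded map $\rho:\mathbb N_0\to\mathbb N_0$. $\omega$ is Schnorr random for $\varphi$ if $\limsup_{n\to\infty}[T(\omega^n)-\rho(n)]\le0$ for every computable test supermartingale $T$ for $\varphi$ and every growth function $\rho$. A Schnorr test for $\varphi$ is a recursive set $A\subseteq\mathbb N_0\times\mathbb S$ with $\overline P_\varphi([A_n])\le2^{-n}$ for all $n$, for which there is a recursive map $e:\mathbb N_0^2\to\mathbb N_0$ (tail bound) with $\overline P_\varphi([A_n]\setminus[A_n^{<\ell}])\le2^{-N}$ for all $(N,n)\in\mathbb N_0^2$ and all $\ell\ge e(N,n)$. $\omega$ is Schnorr test random for $\varphi$ if $\omega\notin\bigcap_n[A_n]$ for every Schnorr test $A$ for $\varphi$. *)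

theory Defs
  imports "HOL-Analysis.Analysis" "HOL-Library.Nat_Bijection"
begin

datatype recf = Zero | Succ | Proj nat | Comp recf "recf list" | Prim recf recf | Mn recf

inductive rec_eval :: "recf \<Rightarrow> nat list \<Rightarrow> nat \<Rightarrow> bool" where
  zero: "rec_eval Zero xs 0"
| succ: "rec_eval Succ (x # xs) (Suc x)"
| proj: "i < length xs \<Longrightarrow> rec_eval (Proj i) xs (xs ! i)"
| comp: "list_all2 (\<lambda>g y. rec_eval g xs y) gs ys \<Longrightarrow> rec_eval f ys z \<Longrightarrow> rec_eval (Comp f gs) xs z"
| prim0: "rec_eval f xs y \<Longrightarrow> rec_eval (Prim f g) (0 # xs) y"
| primS: "rec_eval (Prim f g) (n # xs) y \<Longrightarrow> rec_eval g (y # n # xs) z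
          \<Longrightarrow> rec_eval (Prim f g) (Suc n # xs) z"
| mn: "rec_eval f (y # xs) 0 \<Longrightarrow> (\<forall>k<y. \<exists>v. rec_eval f (k # xs) (Suc v))
          \<Longrightarrow> rec_eval (Mn f) xs y"

definition recursive_map :: "('a \<Rightarrow> nat) \<Rightarrow> ('b \<Rightarrow> nat) \<Rightarrow> ('a \<Rightarrow> 'b) \<Rightarrow> bool" where
  "recursive_map enc_in enc_out f \<longleftrightarrow> (\<exists>c. \<forall>x. rec_eval c [enc_in x] (enc_out (f x)))"

definition enc_nat :: "nat \<Rightarrow> nat" where "enc_nat n = n"

definition enc_str :: "bool list \<Rightarrow> nat" where
  "enc_str s = list_encode (map (\<lambda>b. if b then 1 else 0) s)"

definition enc_rat :: "rat \<Rightarrow> nat" where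
  "enc_rat q = (case quotient_of q of (a, b) \<Rightarrow> prod_encode (int_encode a, nat b))"

definition enc_bool :: "bool \<Rightarrow> nat" where "enc_bool b = (if b then 1 else 0)"

definition enc_pair :: "('a \<Rightarrow> nat) \<Rightarrow> ('b \<Rightarrow> nat) \<Rightarrow> 'a \<times> 'b \<Rightarrow> nat" where
  "enc_pair ea eb p = prod_encode (ea (fst p), eb (snd p))"

definition recursive_set :: "('a \<Rightarrow> nat) \<Rightarrow> 'a set \<Rightarrow> bool" where
  "recursive_set enc A \<longleftrightarrow> recursive_map enc enc_bool (\<lambda>x. x \<in> A)"

definition computable_real_map :: "('d \<Rightarrow> nat) \<Rightarrow> ('d \<Rightarrow> real) \<Rightarrow> bool" where
  "computable_real_map enc r \<longleftrightarrow>
     (\<exists>q :: 'd \<times> nat \<Rightarrow> rat. recursive_map (enc_pair enc enc_nat) enc_rat q \<and>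
        (\<forall>d N. \<bar>r d - real_of_rat (q (d, N))\<bar> \<le> (1/2) ^ N))"

type_synonym path = "nat \<Rightarrow> bool"   \<comment> \<open>True encodes 1, False encodes 0\<close>
type_synonym sit = "bool list"

definition prefix :: "path \<Rightarrow> nat \<Rightarrow> sit" where
  "prefix \<omega> n = map \<omega> [0..<n]"

definition cyl :: "sit \<Rightarrow> path set" where
  "cyl s = {\<omega>. prefix \<omega> (length s) = s}"

definition cylset :: "sit set \<Rightarrow> path set" where
  "cylset B = (\<Union>s\<in>B. cyl s)"

definition level :: "(nat \<times> sit) set \<Rightarrow> nat \<Rightarrow> sit set" where
  "level A n = {s. (n, s) \<in> A}"

definition level_below :: "(nat \<times> sit) set \<Rightarrow> nat \<Rightarrow> nat \<Rightarrow> sit set" where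
  "level_below A n l = {s \<in> level A n. length s < l}"

definition closed_subinterval :: "real set \<Rightarrow> bool" where
  "closed_subinterval I \<longleftrightarrow> (\<exists>a b. 0 \<le> a \<and> a \<le> b \<and> b \<le> 1 \<and> I = {a..b})"

text \<open>Sup of a continuous function over a compact nonempty interval, i.e. the maximum.\<close>
definition upper_exp :: "real set \<Rightarrow> (bool \<Rightarrow> real) \<Rightarrow> real" where
  "upper_exp I f = Sup ((\<lambda>p. p * f True + (1 - p) * f False) ` I)"

definition forecasting_system :: "(sit \<Rightarrow> real set) \<Rightarrow> bool" where
  "forecasting_system \<phi> \<longleftrightarrow> (\<forall>s. closed_subinterval (\<phi> s))"

definition lower_fc :: "(sit \<Rightarrow> real set) \<Rightarrow> sit \<Rightarrow> real" where
  "lower_fc \<phi> s = Inf (\<phi> s)"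

definition upper_fc :: "(sit \<Rightarrow> real set) \<Rightarrow> sit \<Rightarrow> real" where
  "upper_fc \<phi> s = Sup (\<phi> s)"

definition non_degenerate :: "(sit \<Rightarrow> real set) \<Rightarrow> bool" where
  "non_degenerate \<phi> \<longleftrightarrow> (\<forall>s. lower_fc \<phi> s < 1 \<and> upper_fc \<phi> s > 0)"

definition computable_fc :: "(sit \<Rightarrow> real set) \<Rightarrow> bool" where
  "computable_fc \<phi> \<longleftrightarrow> computable_real_map enc_str (lower_fc \<phi>) \<and>
                         computable_real_map enc_str (upper_fc \<phi>)"

definition supermartingale :: "(sit \<Rightarrow> real set) \<Rightarrow> (sit \<Rightarrow> real) \<Rightarrow> bool" where
  "supermartingale \<phi> M \<longleftrightarrow> (\<forall>s. upper_exp (\<phi> s) (\<lambda>x. M (s @ [x])) \<le> M s)"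

definition test_supermartingale :: "(sit \<Rightarrow> real set) \<Rightarrow> (sit \<Rightarrow> real) \<Rightarrow> bool" where
  "test_supermartingale \<phi> M \<longleftrightarrow> supermartingale \<phi> M \<and> (\<forall>s. 0 \<le> M s) \<and> M [] = 1"

definition upper_prob :: "(sit \<Rightarrow> real set) \<Rightarrow> path set \<Rightarrow> ereal" where
  "upper_prob \<phi> G = Inf {ereal (M []) | M. supermartingale \<phi> M \<and>
       (\<forall>\<omega>. liminf (\<lambda>n. ereal (M (prefix \<omega> n))) \<ge> ereal (indicator G \<omega>))}"

definition growth_function :: "(nat \<Rightarrow> nat) \<Rightarrow> bool" where
  "growth_function \<rho> \<longleftrightarrow> recursive_map enc_nat enc_nat \<rho> \<and> mono \<rho> \<and> (\<forall>m. \<exists>n. m \<le> \<rho> n)"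

definition schnorr_random :: "(sit \<Rightarrow> real set) \<Rightarrow> path \<Rightarrow> bool" where
  "schnorr_random \<phi> \<omega> \<longleftrightarrow>
     (\<forall>T \<rho>. test_supermartingale \<phi> T \<and> computable_real_map enc_str T \<and> growth_function \<rho> \<longrightarrow>
        limsup (\<lambda>n. ereal (T (prefix \<omega> n) - real (\<rho> n))) \<le> 0)"

definition schnorr_test :: "(sit \<Rightarrow> real set) \<Rightarrow> (nat \<times> sit) set \<Rightarrow> bool" where
  "schnorr_test \<phi> A \<longleftrightarrow>
     recursive_set (enc_pair enc_nat enc_str) A \<and>
     (\<forall>n. upper_prob \<phi> (cylset (level A n)) \<le> ereal ((1/2) ^ n)) \<and>
     (\<exists>e :: nat \<times> nat \<Rightarrow> nat. recursive_map (enc_pair enc_nat enc_nat) enc_nat e \<and>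
        (\<forall>N n l. e (N, n) \<le> l \<longrightarrow>
           upper_prob \<phi> (cylset (level A n) - cylset (level_below A n l)) \<le> ereal ((1/2) ^ N)))"

definition schnorr_test_random :: "(sit \<Rightarrow> real set) \<Rightarrow> path \<Rightarrow> bool" where
  "schnorr_test_random \<phi> \<omega> \<longleftrightarrow>
     (\<forall>A. schnorr_test \<phi> A \<longrightarrow> \<omega> \<notin> (\<Inter>n. cylset (level A n)))"

end

theory Submission
  imports Defs
begin

text \<open>
  If a computable test supermartingale \<open>T\<close> exceeds a growth function \<open>\<rho>\<close> infinitely often along \<open>\<omega>\<close>,
  then by Ville's inequality the situations \<open>s\<close> with \<open>T s\<close> roughly above \<open>\<rho> (length s) \<ge> 2 ^ n\<close> form a
  Schnorr test capturing \<open>\<omega>\<close>; the growth of \<open>\<rho>\<close> provides the tail bound.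

  Conversely, a Schnorr test is cut along its tail bound into a computable sequence of clopen shells,
  the \<open>N\<close>-th of upper probability at most \<open>2 ^ -(2 N + 2)\<close>, such that every captured path lies in
  infinitely many shells. The price of the \<open>N\<close>-th shell is, up to a small error, a dyadic
  supermartingale computed by backward recursion, and the sum of these prices with weights \<open>2 ^ N\<close>
  is at least \<open>2 ^ N\<close> on the shell, at a depth bounded computably in \<open>N\<close>. Non-degeneracy bounds a
  non-negative supermartingale at \<open>s\<close> by a computable multiple of its initial value, which makes the
  infinite sum computable.
\<close>

section \<open>Closure properties of recursive functions\<close>

text \<open>Upper probability is an infimum over arbitrary real supermartingales and yields no
  strategy that can be computed. For a clopen event every competitor lies above the indicator
  already at a fixed finite depth, so backward recursion from that depth stays, up to rounding,
  below all competitors. This is why a test is cut into shells of bounded length, and the tail bound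
  makes the cuts computable. The constants: rounding adds at most 2^-(2N+2) to the price of the N-th
  shell, so the price is at most 2^-(2N+1) at the root; the weight 2^N leaves 2^-(N+1), and these
  sum to 1. The growth function to be beaten inverts a bound on the depths. At the depth of the N-th
  shell it is at most N, while the capital is at least 2^N \<ge> N + 1, so the gap of 1 recurs
  infinitely often. Recursiveness means evaluation of a concrete term of \<open>recf\<close> on
  naturals, hence all real quantities are carried as natural numerators over powers of two.\<close>

definition trec :: "(nat \<Rightarrow> nat) \<Rightarrow> bool" where
  "trec f \<longleftrightarrow> (\<exists>c. \<forall>x. rec_eval c [x] (f x))"

definition pfst :: "nat \<Rightarrow> nat" where "pfst z = fst (prod_decode z)"
definition psnd :: "nat \<Rightarrow> nat" where "psnd z = snd (prod_decode z)"

lemma pfst_prod_encode [simp]: "pfst (prod_encode (a, b)) = a"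
  and psnd_prod_encode [simp]: "psnd (prod_encode (a, b)) = b"
  and prod_encode_pfst_psnd [simp]: "prod_encode (pfst z, psnd z) = z"
  by (simp_all add: pfst_def psnd_def)

lemma rec_eval_comp1:
  "rec_eval g xs y \<Longrightarrow> rec_eval f [y] z \<Longrightarrow> rec_eval (Comp f [g]) xs z"
  by (rule rec_eval.comp[where ys = "[y]"]) auto

lemma rec_eval_comp2:
  "rec_eval g xs y \<Longrightarrow> rec_eval g' xs y' \<Longrightarrow> rec_eval f [y, y'] z \<Longrightarrow> rec_eval (Comp f [g, g']) xs z"
  by (rule rec_eval.comp[where ys = "[y, y']"]) auto

lemma rec_eval_Proj: "i < length xs \<Longrightarrow> y = xs ! i \<Longrightarrow> rec_eval (Proj i) xs y"
  using rec_eval.proj by simp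

lemma rec_eval_Prim:
  assumes "rec_eval f xs (r 0)" and "\<And>i. rec_eval g (r i # i # xs) (r (Suc i))"
  shows "rec_eval (Prim f g) (n # xs) (r n)"
  by (induction n) (auto intro: rec_eval.prim0 rec_eval.primS assms)

lemma rec_eval_Mn:
  assumes "\<And>k. rec_eval f (k # xs) (F k)" and "\<exists>k. F k = 0"
  shows "rec_eval (Mn f) xs (LEAST k. F k = 0)"
proof (rule rec_eval.mn)
  show "rec_eval f ((LEAST k. F k = 0) # xs) 0"
    using assms(1)[of "LEAST k. F k = 0"] LeastI_ex[OF assms(2)] by simp
  show "\<forall>k<LEAST k. F k = 0. \<exists>v. rec_eval f (k # xs) (Suc v)"
  proof (intro allI impI)
    fix k assume "k < (LEAST k. F k = 0)"
    then have "F k \<noteq> 0" by (rule not_less_Least)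
    then show "\<exists>v. rec_eval f (k # xs) (Suc v)"
      using assms(1)[of k] by (metis not0_implies_Suc)
  qed
qed

section \<open>Arithmetic and the pairing function\<close>

lemma binary_add: "\<exists>c. \<forall>x y. rec_eval c [x, y] (x + y)"
proof (intro exI allI)
  fix x y show "rec_eval (Prim (Proj 0) (Comp Succ [Proj 0])) [x, y] (x + y)"
    by (rule rec_eval_Prim[where r = "\<lambda>i. i + y"])
      (auto intro!: rec_eval_Proj rec_eval_comp1 rec_eval.succ)
qed

lemma binary_diff: "\<exists>c. \<forall>x y. rec_eval c [x, y] (y - x)"
proof (intro exI allI)
  \<comment> \<open>Predecessor: the step returns the counter and ignores the accumulator.
    Subtraction iterates it along the first argument, so the subtrahend comes first.\<close>
  have pred: "rec_eval (Prim Zero (Proj 1)) [n] (n - 1)" for n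
    by (rule rec_eval_Prim[where r = "\<lambda>i. i - 1"]) (auto intro!: rec_eval_Proj rec_eval.zero)
  fix x y
  have "rec_eval (Comp (Prim Zero (Proj 1)) [Proj 0]) [y - i, i, y] (y - Suc i)" for i
    by (rule rec_eval_comp1[of _ _ "y - i"]) (use pred[of "y - i"] in \<open>auto intro: rec_eval_Proj\<close>)
  then show "rec_eval (Prim (Proj 0) (Comp (Prim Zero (Proj 1)) [Proj 0])) [x, y] (y - x)"
    by (intro rec_eval_Prim[where r = "\<lambda>i. y - i"]) (auto intro: rec_eval_Proj)
qed

lemma binary_mult: "\<exists>c. \<forall>x y. rec_eval c [x, y] (x * y)"
proof -
  obtain a where a: "\<And>x y. rec_eval a [x, y] (x + y)" using binary_add by blast
  have "rec_eval (Prim Zero (Comp a [Proj 2, Proj 0])) [x, y] (x * y)" for x y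
    by (rule rec_eval_Prim[where r = "\<lambda>i. i * y"])
      (auto intro!: rec_eval_Proj rec_eval_comp2 rec_eval.zero a)
  then show ?thesis by blast
qed

lemma unary_triangle: "\<exists>c. \<forall>x. rec_eval c [x] (triangle x)"
proof -
  obtain a where a: "\<And>x y. rec_eval a [x, y] (x + y)" using binary_add by blast
  have "rec_eval (Prim Zero (Comp Succ [Comp a [Proj 0, Proj 1]])) [x] (triangle x)" for x
    by (rule rec_eval_Prim[where r = triangle])
      (auto intro!: rec_eval_Proj rec_eval_comp2 rec_eval_comp1 rec_eval.zero rec_eval.succ a)
  then show ?thesis by blast
qed

lemma binary_prod_encode: "\<exists>c. \<forall>x y. rec_eval c [x, y] (prod_encode (x, y))"
proof -
  obtain a where a: "\<And>x y. rec_eval a [x, y] (x + y)" using binary_add by blast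
  obtain t where t: "\<And>x. rec_eval t [x] (triangle x)" using unary_triangle by blast
  have "rec_eval (Comp a [Comp t [a], Proj 0]) [x, y] (prod_encode (x, y))" for x y
    unfolding prod_encode_def using a t
    by (auto intro!: rec_eval_Proj rec_eval_comp2 rec_eval_comp1)
  then show ?thesis by blast
qed

lemma trec_comp: "trec f \<Longrightarrow> trec g \<Longrightarrow> trec (\<lambda>x. f (g x))"
  unfolding trec_def by (blast intro: rec_eval_comp1)

lemma trec_binary:
  assumes "\<exists>c. \<forall>x y. rec_eval c [x, y] (h x y)" and "trec f" and "trec g"
  shows "trec (\<lambda>x. h (f x) (g x))"
  using assms unfolding trec_def by (blast intro: rec_eval_comp2)

lemma trec_id: "trec (\<lambda>x. x)"
  unfolding trec_def by (rule exI[of _ "Proj 0"]) (auto intro: rec_eval_Proj)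

lemma trec_Suc: "trec f \<Longrightarrow> trec (\<lambda>x. Suc (f x))"
  unfolding trec_def by (blast intro: rec_eval_comp1 rec_eval.succ)

lemma trec_const: "trec (\<lambda>x. c)"
proof (induction c)
  case 0
  show ?case unfolding trec_def by (blast intro: rec_eval.zero)
qed (rule trec_Suc)

lemma trec_add: "trec f \<Longrightarrow> trec g \<Longrightarrow> trec (\<lambda>x. f x + g x)"
  by (rule trec_binary[OF binary_add])

lemma trec_mult: "trec f \<Longrightarrow> trec g \<Longrightarrow> trec (\<lambda>x. f x * g x)"
  by (rule trec_binary[OF binary_mult])

lemma trec_diff: "trec f \<Longrightarrow> trec g \<Longrightarrow> trec (\<lambda>x. f x - g x)"
  by (rule trec_binary[OF binary_diff])

lemma trec_prod_encode: "trec f \<Longrightarrow> trec g \<Longrightarrow> trec (\<lambda>x. prod_encode (f x, g x))"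
  by (rule trec_binary[OF binary_prod_encode])

section \<open>Decoding of pairs\<close>

lemma triangle_psum: "triangle (pfst z + psnd z) + pfst z = z"
  using prod_encode_pfst_psnd[of z] by (simp add: prod_encode_def del: prod_encode_pfst_psnd)

text \<open>Pairs are numbered along diagonals, and the diagonal of index \<open>k + 1\<close>
  starts at \<open>triangle (Suc k)\<close>. The condition says \<open>z < triangle (Suc k)\<close>
  in a form that \<open>Mn\<close> can search for.\<close>

lemma psum_eq: "pfst z + psnd z = (LEAST k. Suc z - triangle (Suc k) = 0)"
proof (rule sym, rule Least_equality)
  have "triangle (Suc (pfst z + psnd z)) = triangle (pfst z + psnd z) + Suc (pfst z + psnd z)"
    by simp
  then show "Suc z - triangle (Suc (pfst z + psnd z)) = 0"
    using triangle_psum[of z] by linarith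
  fix k assume k: "Suc z - triangle (Suc k) = 0"
  show "pfst z + psnd z \<le> k"
  proof (rule ccontr)
    assume "\<not> ?thesis"
    then have "Suc k \<le> pfst z + psnd z" by linarith
    then have "triangle (Suc k) \<le> triangle (pfst z + psnd z)"
      by (rule lift_Suc_mono_le[rotated]) (simp only: triangle_Suc le_add1)
    then show False using k triangle_psum[of z] by linarith
  qed
qed

lemma trec_psum: "trec (\<lambda>z. pfst z + psnd z)"
proof -
  obtain d where d: "\<And>x y. rec_eval d [x, y] (y - x)" using binary_diff by blast
  obtain t where t: "\<And>x. rec_eval t [x] (triangle x)" using unary_triangle by blast
  let ?F = "Comp d [Comp t [Comp Succ [Proj 0]], Comp Succ [Proj 1]]"
  have "rec_eval ?F [k, z] (Suc z - triangle (Suc k))" for k z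
    by (rule rec_eval_comp2[OF rec_eval_comp1[OF rec_eval_comp1 t] rec_eval_comp1 d])
      (auto intro: rec_eval_Proj rec_eval.succ)
  moreover have "\<exists>k. Suc z - triangle (Suc k) = 0" for z
    by (rule exI[of _ z]) simp
  ultimately have "rec_eval (Mn ?F) [z] (pfst z + psnd z)" for z
    unfolding psum_eq by (rule rec_eval_Mn)
  then show ?thesis unfolding trec_def by blast
qed

lemma trec_pfst_id: "trec pfst"
proof -
  have "trec (\<lambda>z. triangle (pfst z + psnd z))"
    by (rule trec_comp[OF _ trec_psum]) (use unary_triangle in \<open>simp add: trec_def\<close>)
  then have "trec (\<lambda>z. z - triangle (pfst z + psnd z))"
    by (rule trec_diff[OF trec_id])
  also have "(\<lambda>z. z - triangle (pfst z + psnd z)) = pfst"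
  proof
    fix z show "z - triangle (pfst z + psnd z) = pfst z" using triangle_psum[of z] by linarith
  qed
  finally show ?thesis .
qed

lemma trec_psnd_id: "trec psnd"
  using trec_diff[OF trec_psum trec_pfst_id] by simp

lemma trec_pfst: "trec f \<Longrightarrow> trec (\<lambda>x. pfst (f x))"
  and trec_psnd: "trec f \<Longrightarrow> trec (\<lambda>x. psnd (f x))"
  by (rule trec_comp[OF trec_pfst_id] trec_comp[OF trec_psnd_id], assumption)+

text \<open>Binary maps are treated as unary maps on packed pairs: a hypothesis of the form
  \<open>trec (\<lambda>z. f (pfst z) (psnd z))\<close> stands for recursiveness of \<open>f\<close>
  in both arguments.\<close>

lemma trec_comp2:
  assumes "trec (\<lambda>z. f (pfst z) (psnd z))" and "trec a" and "trec b"
  shows "trec (\<lambda>x. f (a x) (b x))"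
  using trec_comp[OF assms(1) trec_prod_encode[OF assms(2,3)]] by simp

lemma trec_rec_nat:
  assumes "trec g" and "trec (\<lambda>z. h (pfst z) (pfst (psnd z)) (psnd (psnd z)))" and "trec k"
  shows "trec (\<lambda>x. rec_nat (g x) (h x) (k x))"
proof -
  obtain p where p: "\<And>x y. rec_eval p [x, y] (prod_encode (x, y))"
    using binary_prod_encode by blast
  obtain cg where cg: "\<And>x. rec_eval cg [x] (g x)" using assms(1) unfolding trec_def by blast
  obtain ch where ch: "\<And>z. rec_eval ch [z] (h (pfst z) (pfst (psnd z)) (psnd (psnd z)))"
    using assms(2) unfolding trec_def by blast
  obtain ck where ck: "\<And>x. rec_eval ck [x] (k x)" using assms(3) unfolding trec_def by blast
  \<comment> \<open>\<open>Prim\<close> passes the accumulator, the counter and the parameter in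
    this order; \<open>ch\<close> expects them packed in the reverse order.\<close>
  let ?H = "Comp ch [Comp p [Proj 2, Comp p [Proj 1, Proj 0]]]"
  have H: "rec_eval ?H [y, i, x] (h x i y)" for x i y
    using ch[of "prod_encode (x, prod_encode (i, y))"]
    by (auto intro!: rec_eval_comp1 rec_eval_comp2[OF _ _ p] rec_eval_Proj)
  have "rec_eval (Prim cg ?H) [n, x] (rec_nat (g x) (h x) n)" for n x
    by (rule rec_eval_Prim[where r = "rec_nat (g x) (h x)"]) (use cg H in auto)
  then have "rec_eval (Comp (Prim cg ?H) [ck, Proj 0]) [x] (rec_nat (g x) (h x) (k x))" for x
    using ck by (auto intro!: rec_eval_comp2 rec_eval_Proj)
  then show ?thesis unfolding trec_def by blast
qed

section \<open>Decidable predicates, bounded and unbounded search\<close>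

definition dec :: "(nat \<Rightarrow> bool) \<Rightarrow> bool" where
  "dec P \<longleftrightarrow> trec (\<lambda>x. of_bool (P x))"

lemma dec_comp2:
  assumes "dec (\<lambda>z. P (pfst z) (psnd z))" and "trec a" and "trec b"
  shows "dec (\<lambda>x. P (a x) (b x))"
  using trec_comp2[of "\<lambda>x y. of_bool (P x y)"] assms unfolding dec_def by blast

lemma dec_le: "trec f \<Longrightarrow> trec g \<Longrightarrow> dec (\<lambda>x. f x \<le> g x)"
proof -
  assume "trec f" "trec g"
  then have "trec (\<lambda>x. 1 - (f x - g x))" by (intro trec_diff trec_const)
  also have "(\<lambda>x. 1 - (f x - g x)) = (\<lambda>x. of_bool (f x \<le> g x))" by auto
  finally show ?thesis unfolding dec_def .
qed

lemma dec_not: "dec P \<Longrightarrow> dec (\<lambda>x. \<not> P x)"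
proof -
  assume "dec P"
  then have "trec (\<lambda>x. 1 - of_bool (P x))" unfolding dec_def by (intro trec_diff trec_const)
  also have "(\<lambda>x. 1 - of_bool (P x)) = (\<lambda>x. of_bool (\<not> P x) :: nat)" by auto
  finally show ?thesis unfolding dec_def .
qed

lemma dec_conj: "dec P \<Longrightarrow> dec Q \<Longrightarrow> dec (\<lambda>x. P x \<and> Q x)"
  unfolding dec_def of_bool_conj by (rule trec_mult)

lemma dec_less: "trec f \<Longrightarrow> trec g \<Longrightarrow> dec (\<lambda>x. f x < g x)"
  unfolding not_le[symmetric] by (intro dec_not dec_le)

lemma dec_eq: "trec f \<Longrightarrow> trec g \<Longrightarrow> dec (\<lambda>x. f x = g x)"
  unfolding eq_iff by (intro dec_conj dec_le)

lemma trec_if: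
  assumes "dec P" "trec f" "trec g"
  shows "trec (\<lambda>x. if P x then f x else g x)"
proof -
  have "trec (\<lambda>x. of_bool (P x) * f x + (1 - of_bool (P x)) * g x)"
    using assms unfolding dec_def by (intro trec_add trec_mult trec_diff trec_const)
  also have "(\<lambda>x. of_bool (P x) * f x + (1 - of_bool (P x)) * g x) =
      (\<lambda>x. if P x then f x else g x)" by auto
  finally show ?thesis .
qed

lemma trec_min: "trec f \<Longrightarrow> trec g \<Longrightarrow> trec (\<lambda>x. min (f x) (g x))"
  and trec_max: "trec f \<Longrightarrow> trec g \<Longrightarrow> trec (\<lambda>x. max (f x) (g x))"
  unfolding min_def max_def by (intro trec_if dec_le; assumption)+

lemma trec_sum:
  assumes "trec (\<lambda>z. f (pfst z) (psnd z))" and "trec k"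
  shows "trec (\<lambda>x. \<Sum>i<k x. f x i)"
proof -
  have "(\<Sum>i<n. f x i) = rec_nat 0 (\<lambda>i y. y + f x i) n" for x n
    by (induction n) auto
  moreover have "trec (\<lambda>x. rec_nat 0 (\<lambda>i y. y + f x i) (k x))"
    by (intro trec_rec_nat trec_add trec_comp2[OF assms(1)] trec_const trec_pfst trec_psnd
        trec_id assms(2))
  ultimately show ?thesis by simp
qed

lemma dec_bex:
  assumes "dec (\<lambda>z. P (pfst z) (psnd z))" and "trec k"
  shows "dec (\<lambda>x. \<exists>i<k x. P x i)"
proof -
  have "dec (\<lambda>x. 1 \<le> (\<Sum>i<k x. of_bool (P x i) :: nat))"
    using assms unfolding dec_def[of "\<lambda>z. P (pfst z) (psnd z)"]
    by (intro dec_le trec_const trec_sum)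
  also have "(\<lambda>x. 1 \<le> (\<Sum>i<k x. of_bool (P x i) :: nat)) = (\<lambda>x. \<exists>i<k x. P x i)"
  proof
    fix x
    have "1 \<le> (\<Sum>i<k x. of_bool (P x i) :: nat) \<longleftrightarrow> (\<Sum>i<k x. of_bool (P x i) :: nat) \<noteq> 0" by linarith
    also have "\<dots> \<longleftrightarrow> (\<exists>i<k x. P x i)"
      by (subst sum_eq_0_iff) auto
    finally show "1 \<le> (\<Sum>i<k x. of_bool (P x i) :: nat) \<longleftrightarrow> (\<exists>i<k x. P x i)" .
  qed
  finally show ?thesis .
qed

text \<open>\<open>Mn\<close> looks for a zero and takes the search variable first, so it is applied
  to the negated predicate with the arguments swapped.\<close>

lemma trec_Least:
  assumes "dec (\<lambda>z. P (pfst z) (psnd z))" and "\<And>x. \<exists>y. P x y"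
  shows "trec (\<lambda>x. LEAST y. P x y)"
proof -
  have "trec (\<lambda>z. of_bool (\<not> P (psnd z) (pfst z)))"
    using dec_not[OF dec_comp2[OF assms(1) trec_psnd_id trec_pfst_id]] unfolding dec_def .
  then obtain c where c: "\<And>z. rec_eval c [z] (of_bool (\<not> P (psnd z) (pfst z)))"
    unfolding trec_def by blast
  obtain p where p: "\<And>x y. rec_eval p [x, y] (prod_encode (x, y))"
    using binary_prod_encode by blast
  have "rec_eval (Comp c [p]) [y, x] (of_bool (\<not> P x y))" for x y
    using rec_eval_comp1[OF p c, of y x] by simp
  moreover have "\<exists>y. of_bool (\<not> P x y) = (0 :: nat)" for x
    using assms(2)[of x] by auto
  ultimately have "rec_eval (Mn (Comp c [p])) [x] (LEAST y. of_bool (\<not> P x y) = (0 :: nat))" for x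
    by (rule rec_eval_Mn)
  then show ?thesis unfolding trec_def by auto
qed

lemma trec_div: "trec f \<Longrightarrow> trec g \<Longrightarrow> trec (\<lambda>x. f x div g x)"
proof -
  assume fg: "trec f" "trec g"
  \<comment> \<open>The disjunct \<open>b = 0\<close> ends the search at 0, in agreement with
    \<open>a div 0 = 0\<close>.\<close>
  have "(LEAST q. b = 0 \<or> a < Suc q * b) = a div b" for a b :: nat
  proof (rule Least_equality)
    show "b = 0 \<or> a < Suc (a div b) * b"
      using dividend_less_div_times[of b a] by auto
    show "a div b \<le> q" if "b = 0 \<or> a < Suc q * b" for q
      using that less_mult_imp_div_less[of a "Suc q" b] by auto
  qed
  \<comment> \<open>The same condition, spelled with \<open>dec_not\<close> and
    \<open>dec_conj\<close> in place of the disjunction.\<close>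
  moreover have "trec (\<lambda>x. LEAST q. \<not> (g x \<noteq> 0 \<and> \<not> f x < Suc q * g x))"
  proof (intro trec_Least dec_not dec_conj dec_eq dec_less trec_const trec_mult trec_Suc
      trec_comp[OF fg(1)] trec_comp[OF fg(2)] trec_pfst trec_psnd trec_id)
    show "\<exists>q. \<not> (g x \<noteq> 0 \<and> \<not> f x < Suc q * g x)" for x
      by (rule exI[of _ "f x"], cases "g x") auto
  qed
  ultimately show ?thesis by simp
qed

lemma trec_mod: "trec f \<Longrightarrow> trec g \<Longrightarrow> trec (\<lambda>x. f x mod g x)"
  unfolding minus_div_mult_eq_mod[symmetric] by (intro trec_diff trec_mult trec_div)

lemma trec_power: "trec f \<Longrightarrow> trec g \<Longrightarrow> trec (\<lambda>x. f x ^ g x)"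
proof -
  assume fg: "trec f" "trec g"
  have "a ^ n = rec_nat 1 (\<lambda>_ y. a * y) n" for a n :: nat
    by (induction n) auto
  moreover have "trec (\<lambda>x. rec_nat 1 (\<lambda>_ y. f x * y) (g x))"
    by (intro trec_rec_nat trec_mult trec_const trec_comp[OF fg(1)] trec_pfst trec_psnd
        trec_id fg)
  ultimately show ?thesis by simp
qed

lemmas trec_intros = trec_id trec_const trec_Suc trec_add trec_mult trec_diff trec_prod_encode
  trec_pfst trec_psnd trec_if trec_min trec_max trec_div trec_mod trec_power
  dec_le dec_less dec_eq dec_not dec_conj

section \<open>Binary strings as numbers\<close>

text \<open>The situation \<open>s\<close> is represented by the number with binary expansion \<open>1s\<close>, so that
  extension is doubling and truncation is halving.\<close>

definition beta :: "sit \<Rightarrow> nat" where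
  "beta s = foldl (\<lambda>b x. 2 * b + of_bool x) 1 s"

fun str_of :: "nat \<Rightarrow> sit" where
  "str_of b = (if b \<le> 1 then [] else str_of (b div 2) @ [odd b])"

declare str_of.simps [simp del]

lemma str_of_eq_Nil [simp]: "b \<le> 1 \<Longrightarrow> str_of b = []"
  by (simp add: str_of.simps)

lemma beta_Nil [simp]: "beta [] = 1"
  and beta_snoc [simp]: "beta (s @ [x]) = 2 * beta s + of_bool x"
  by (simp_all add: beta_def)

lemma beta_pos [simp]: "0 < beta s"
  by (induction s rule: rev_induct) auto

lemma str_of_beta [simp]: "str_of (beta s) = s"
proof (induction s rule: rev_induct)
  case Nil
  show ?case by (simp add: str_of.simps)
next
  case (snoc x s)
  have "\<not> 2 * beta s + of_bool x \<le> 1" using beta_pos[of s] by linarith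
  moreover have "(2 * beta s + of_bool x) div 2 = beta s" by simp
  ultimately show ?case using snoc by (subst str_of.simps) auto
qed

lemma str_of_div_2: "str_of (b div 2) = butlast (str_of b)"
proof (cases "b \<le> 1")
  case True
  then have "b div 2 \<le> 1" by linarith
  then show ?thesis using True by simp
qed (simp add: str_of.simps[of b])

lemma str_of_div_power: "str_of (b div 2 ^ j) = take (length (str_of b) - j) (str_of b)"
proof (induction j)
  case (Suc j)
  have "str_of (b div 2 ^ Suc j) = butlast (str_of (b div 2 ^ j))"
    by (simp only: power_Suc2 div_mult2_eq str_of_div_2)
  then show ?case
    using Suc butlast_take[of "length (str_of b) - j" "str_of b"] by simp
qed simp

text \<open>Situations of length \<open>n\<close> occupy the numbers from \<open>2 ^ n\<close> to
  \<open>2 ^ Suc n - 1\<close>, so depth in the tree becomes a comparison with a power of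
  two.\<close>

lemma length_str_of_le_iff: "length (str_of b) \<le> k \<longleftrightarrow> b < 2 ^ Suc k"
proof (induction b arbitrary: k rule: str_of.induct)
  case (1 b)
  show ?case
  proof (cases "b \<le> 1")
    case True
    have "(2 :: nat) \<le> 2 ^ Suc k" by simp
    then have "b < 2 ^ Suc k" using True by linarith
    then show ?thesis using True by simp
  next
    case b: False
    show ?thesis
    proof (cases k)
      case 0
      then show ?thesis using b by (simp add: str_of.simps[of b])
    next
      case (Suc k')
      have "length (str_of b) \<le> k \<longleftrightarrow> length (str_of (b div 2)) \<le> k'"
        using b Suc by (simp add: str_of.simps[of b])
      also have "\<dots> \<longleftrightarrow> b div 2 < 2 ^ Suc k'" using 1 b by blast
      also have "\<dots> \<longleftrightarrow> b < 2 ^ Suc k" unfolding Suc by (simp add: div_less_iff_less_mult mult.commute)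
      finally show ?thesis .
    qed
  qed
qed

lemma length_less_iff_beta: "length s < k \<longleftrightarrow> beta s < 2 ^ k"
  using length_str_of_le_iff[of "beta s" "k - 1"] by (cases k) (auto simp: less_Suc_eq_le)

lemma trec_length_str_of: "trec f \<Longrightarrow> trec (\<lambda>x. length (str_of (f x)))"
proof (rule trec_comp[of "\<lambda>b. length (str_of b)"])
  have "(LEAST k. b < 2 ^ Suc k) = length (str_of b)" for b
    by (rule Least_equality) (auto simp only: length_str_of_le_iff[symmetric])
  moreover have "trec (\<lambda>b. LEAST k. b < 2 ^ Suc k)"
    by (intro trec_Least trec_intros) (auto simp only: length_str_of_le_iff[symmetric])
  ultimately show "trec (\<lambda>b. length (str_of b))" by simp
qed

section \<open>Conversion between \<open>enc_str\<close> and the binary numbering\<close>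

lemma enc_str_Nil [simp]: "enc_str [] = 0"
  and enc_str_Cons [simp]: "enc_str (x # s) = Suc (prod_encode (of_bool x, enc_str s))"
  by (auto simp: enc_str_def)

lemma trec_enc_str_str_of: "trec f \<Longrightarrow> trec (\<lambda>x. enc_str (str_of (f x)))"
proof (rule trec_comp[of "\<lambda>b. enc_str (str_of b)"])
  \<comment> \<open>The number yields its last bit first, and \<open>enc_str\<close> is built from
    the back. The state pairs what is left of the number with the code of the suffix already split
    off.\<close>
  define st where "st b = rec_nat (prod_encode (b, 0)) (\<lambda>_ p. if pfst p \<le> 1 then p
      else prod_encode (pfst p div 2, Suc (prod_encode (pfst p mod 2, psnd p))))" for b
  \<comment> \<open>The last disjunct makes \<open>b\<close> iterations enough: for
    \<open>i = b\<close> it too forces \<open>b' \<le> 1\<close>.\<close>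
  have inv: "\<exists>b' t. st b i = prod_encode (b', enc_str t) \<and> str_of b' @ t = str_of b \<and>
      (b' \<le> 1 \<or> b' + i \<le> b)" for b i
  proof (induction i)
    case 0
    show ?case by (rule exI[of _ b], rule exI[of _ "[]"]) (simp add: st_def)
  next
    case (Suc i)
    then obtain b' t where IH: "st b i = prod_encode (b', enc_str t)" "str_of b' @ t = str_of b"
      "b' \<le> 1 \<or> b' + i \<le> b" by blast
    have step: "st b (Suc i) = (if b' \<le> 1 then st b i
        else prod_encode (b' div 2, Suc (prod_encode (b' mod 2, enc_str t))))"
      using IH(1) by (simp add: st_def)
    show ?case
    proof (cases "b' \<le> 1")
      case True
      then show ?thesis using IH step by auto
    next
      case False
      have "st b (Suc i) = prod_encode (b' div 2, enc_str (odd b' # t))"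
        using step False by (simp add: mod_2_eq_odd)
      moreover have "str_of (b' div 2) @ odd b' # t = str_of b"
        using IH(2) False by (simp add: str_of.simps[of b'])
      moreover have "b' div 2 + Suc i \<le> b" using IH(3) False by linarith
      ultimately show ?thesis by blast
    qed
  qed
  have "psnd (st b b) = enc_str (str_of b)" for b
  proof -
    obtain b' t where "st b b = prod_encode (b', enc_str t)" "str_of b' @ t = str_of b" "b' \<le> 1"
      using inv[of b b] by fastforce
    then show ?thesis by (simp add: str_of.simps[of b'])
  qed
  moreover have "trec (\<lambda>b. psnd (st b b))"
    unfolding st_def by (intro trec_rec_nat trec_intros)
  ultimately show "trec (\<lambda>b. enc_str (str_of b))" by simp
qed

lemma length_le_enc_str: "length s \<le> enc_str s"
proof (induction s)
  case (Cons x s)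
  then show ?case using le_prod_encode_2[of "enc_str s" "of_bool x"] by simp
qed simp

lemma ex_trec_beta: "\<exists>g. trec g \<and> (\<forall>s. g (enc_str s) = beta s)"
proof -
  \<comment> \<open>Now bits are read from the front: the state pairs \<open>beta\<close> of the
    part read with the code of the rest. Running for \<open>c\<close> steps is enough by
    \<open>length_le_enc_str\<close>.\<close>
  define st where "st c = rec_nat (prod_encode (1, c)) (\<lambda>_ p. if psnd p = 0 then p
      else prod_encode (2 * pfst p + pfst (psnd p - 1), psnd (psnd p - 1)))" for c
  have inv: "st (enc_str s) i = prod_encode (beta (take i s), enc_str (drop i s))" for s i
  proof (induction i)
    case 0
    show ?case by (simp add: st_def)
  next
    case (Suc i)
    have step: "st (enc_str s) (Suc i) = (if enc_str (drop i s) = 0 then st (enc_str s) i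
        else prod_encode (2 * beta (take i s) + pfst (enc_str (drop i s) - 1),
          psnd (enc_str (drop i s) - 1)))"
      using Suc by (simp add: st_def)
    show ?case
    proof (cases "i < length s")
      case True
      then have "drop i s = s ! i # drop (Suc i) s" "take (Suc i) s = take i s @ [s ! i]"
        by (auto simp: Cons_nth_drop_Suc take_Suc_conv_app_nth)
      then show ?thesis using step by simp
    next
      case False
      then show ?thesis using step Suc by simp
    qed
  qed
  have "pfst (st (enc_str s) (enc_str s)) = beta s" for s
    using inv[of s "enc_str s"] length_le_enc_str[of s] by simp
  moreover have "trec (\<lambda>c. pfst (st c c))"
    unfolding st_def by (intro trec_rec_nat trec_intros)
  ultimately show ?thesis by blast
qed

section \<open>Transfer between \<open>recursive_map\<close> on encoded sets and
  \<open>trec\<close>\<close>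

lemma trec_recursive_map:
  assumes "recursive_map ei eo f" and "trec (\<lambda>x. ei (g x))"
  shows "trec (\<lambda>x. eo (f (g x)))"
  using assms unfolding trec_def recursive_map_def by (blast intro: rec_eval_comp1)

lemma recursive_map_pairI:
  assumes "trec (\<lambda>z. F (pfst z) (psnd z))" and "\<And>x y. F (ea x) (eb y) = eo (f (x, y))"
  shows "recursive_map (enc_pair ea eb) eo f"
proof -
  obtain c where "\<And>z. rec_eval c [z] (F (pfst z) (psnd z))" using assms(1) unfolding trec_def by blast
  then have "rec_eval c [prod_encode (ea x, eb y)] (eo (f (x, y)))" for x y
    using assms(2)[of x y] by (metis pfst_prod_encode psnd_prod_encode)
  then show ?thesis unfolding recursive_map_def enc_pair_def by auto
qed

lemma dec_recursive_set:
  assumes "recursive_set (enc_pair enc_nat enc_str) A" and "trec f" and "trec g"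
  shows "dec (\<lambda>x. (f x, str_of (g x)) \<in> A)"
proof -
  have "trec (\<lambda>x. enc_bool ((f x, str_of (g x)) \<in> A))"
    using assms(1) unfolding recursive_set_def
    by (rule trec_recursive_map)
      (simp add: enc_pair_def enc_nat_def, intro trec_intros trec_enc_str_str_of assms)
  then show ?thesis unfolding dec_def enc_bool_def of_bool_def .
qed

text \<open>Prefixes arise by halving, so this is a bounded search over the number \<open>j\<close>
  of removed bits.\<close>

lemma dec_ex_prefix:
  assumes "dec (\<lambda>z. P (pfst z) (str_of (psnd z)))" and "trec f" and "trec g"
  shows "dec (\<lambda>x. \<exists>i\<le>length (str_of (g x)). P (f x) (take i (str_of (g x))))"
proof -
  have "dec (\<lambda>x. \<exists>j<Suc (length (str_of (g x))). P (f x) (str_of (g x div 2 ^ j)))"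
    by (intro dec_bex dec_comp2[OF assms(1)] trec_comp[OF assms(2)] trec_comp[OF assms(3)]
        trec_intros trec_length_str_of assms(3))
  also have "(\<lambda>x. \<exists>j<Suc (length (str_of (g x))). P (f x) (str_of (g x div 2 ^ j))) =
      (\<lambda>x. \<exists>i\<le>length (str_of (g x)). P (f x) (take i (str_of (g x))))"
    unfolding str_of_div_power
  proof (intro ext iffI)
    fix x
    let ?n = "length (str_of (g x))"
    assume "\<exists>i\<le>?n. P (f x) (take i (str_of (g x)))"
    then obtain i where "i \<le> ?n" "P (f x) (take i (str_of (g x)))" by blast
    then show "\<exists>j<Suc ?n. P (f x) (take (?n - j) (str_of (g x)))"
      by (intro exI[of _ "?n - i"]) auto
  qed (meson diff_le_self)
  finally show ?thesis .
qed

section \<open>Computable real maps\<close>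

lemma real_div_less_nat_div:
  assumes "0 < d" shows "real n / real d < real (n div d) + 1"
proof -
  have "real n < real (d + n div d * d)"
    using dividend_less_div_times[OF assms, of n] by (simp only: of_nat_less_iff)
  also have "\<dots> = (real (n div d) + 1) * real d" by (simp add: algebra_simps)
  finally show ?thesis using assms by (simp add: divide_less_eq)
qed

text \<open>After scaling by \<open>2 ^ J\<close> the rational approximation is off by at most 1,
  and rounding down loses less than 1 more; hence slack 1 on one side and 2 on the other.\<close>

lemma computable_real_map_approx:
  assumes "computable_real_map enc_str r" and nonneg: "\<And>s. 0 \<le> r s"
  obtains Q where "trec (\<lambda>z. Q (pfst z) (psnd z))"
    and "\<And>b J. real (Q b J) \<le> 2 ^ J * r (str_of b) + 1"
    and "\<And>b J. 2 ^ J * r (str_of b) \<le> real (Q b J) + 2"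
proof -
  obtain q where q: "recursive_map (enc_pair enc_str enc_nat) enc_rat q"
    and approx: "\<And>s J. \<bar>r s - real_of_rat (q (s, J))\<bar> \<le> (1/2) ^ J"
    using assms(1) unfolding computable_real_map_def by blast
  define u where "u b J = enc_rat (q (str_of b, J))" for b J
  \<comment> \<open>\<open>int_encode\<close> is even exactly on non-negative integers. A negative
    approximation is replaced by 0, which stays within the bounds because \<open>r\<close> is
    non-negative.\<close>
  define Q where "Q b J = (if pfst (u b J) mod 2 = 0
      then (2 ^ J * (pfst (u b J) div 2)) div psnd (u b J) else 0)" for b J
  have u: "trec (\<lambda>z. u (pfst z) (psnd z))"
    unfolding u_def using q
    by (rule trec_recursive_map)
      (simp add: enc_pair_def enc_nat_def, intro trec_intros trec_enc_str_str_of)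
  have "trec (\<lambda>z. Q (pfst z) (psnd z))"
    unfolding Q_def by (intro trec_intros u)
  moreover have "real (Q b J) \<le> 2 ^ J * r (str_of b) + 1 \<and> 2 ^ J * r (str_of b) \<le> real (Q b J) + 2" for b J
  proof -
    obtain a d where ad: "quotient_of (q (str_of b, J)) = (a, d)" by fastforce
    have d: "d > 0" using quotient_of_denom_pos[OF ad] .
    have "q (str_of b, J) = of_int a / of_int d" using quotient_of_div[OF ad] .
    then have x: "real_of_rat (q (str_of b, J)) = of_int a / of_int d"
      by (simp add: of_rat_divide)
    have uu: "u b J = prod_encode (int_encode a, nat d)"
      by (simp add: u_def enc_rat_def ad)
    have "2 ^ J * \<bar>r (str_of b) - of_int a / of_int d\<bar> \<le> 2 ^ J * (1/2) ^ J"
      using approx[of "str_of b" J] x by (intro mult_left_mono) auto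
    also have "\<dots> = (1 :: real)" by (simp add: power_one_over)
    finally have "\<bar>2 ^ J * r (str_of b) - 2 ^ J * (of_int a / of_int d)\<bar> \<le> 1"
      by (simp only: right_diff_distrib[symmetric] abs_mult) simp
    then have close: "2 ^ J * r (str_of b) \<le> 2 ^ J * (of_int a / of_int d) + 1"
      "2 ^ J * (of_int a / of_int d) \<le> 2 ^ J * r (str_of b) + 1" by linarith+
    show ?thesis
    proof (cases "0 \<le> a")
      case True
      then have "int_encode a = 2 * nat a" by (simp add: int_encode_def sum_encode_def)
      then have Q: "Q b J = (2 ^ J * nat a) div nat d"
        by (simp add: Q_def uu)
      have "2 ^ J * (of_int a / of_int d) = real (2 ^ J * nat a) / real (nat d)"
        using True d by simp
      then show ?thesis
        using close of_nat_div_le_of_nat[where ?'a = real, of "2 ^ J * nat a" "nat d"]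
          real_div_less_nat_div[of "nat d" "2 ^ J * nat a"] d unfolding Q by (intro conjI) linarith+
    next
      case False
      then have "int_encode a = Suc (2 * nat (- a - 1))"
        by (simp add: int_encode_def sum_encode_def)
      then have Q: "Q b J = 0"
        by (simp add: Q_def uu mod_Suc)
      have "2 ^ J * (of_int a / of_int d) \<le> (0 :: real)"
        using False d by (intro mult_nonneg_nonpos divide_nonpos_pos) auto
      moreover have "0 \<le> 2 ^ J * r (str_of b)" using nonneg by simp
      ultimately show ?thesis using close unfolding Q by simp
    qed
  qed
  ultimately show thesis using that by blast
qed

text \<open>Odd numerators over powers of two are already in lowest terms, so that their codes are
  obtained without computing greatest common divisors.\<close>

lemma enc_rat_odd_dyadic:
  "enc_rat (Fract (int (2 * X + 1)) (2 ^ Suc E)) = prod_encode (2 * (2 * X + 1), 2 ^ Suc E)"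
proof -
  have "coprime (int (2 * X + 1)) (2 ^ Suc E)"
    by (auto simp: coprime_power_right_iff)
  then have "quotient_of (Fract (int (2 * X + 1)) (2 ^ Suc E)) = (int (2 * X + 1), 2 ^ Suc E)"
    by (simp only: quotient_of_Fract normalize_stable) simp
  moreover have "int_encode (int (2 * X + 1)) = 2 * (2 * X + 1)"
    by (simp add: int_encode_def sum_encode_def)
  moreover have "nat (2 ^ Suc E) = 2 ^ Suc E" by (simp only: nat_power_eq) simp
  ultimately show ?thesis unfolding enc_rat_def by (simp only: prod.case)
qed

text \<open>The approximation is \<open>X / 2 ^ E\<close> moved up by half a unit to make the
  numerator odd; the error bound has to absorb this shift.\<close>

lemma computable_real_map_dyadicI:
  assumes X: "trec (\<lambda>z. X (pfst z) (psnd z))" and E: "trec (\<lambda>z. E (pfst z) (psnd z))"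
    and approx: "\<And>s M. \<bar>r s - (2 * real (X (beta s) M) + 1) / 2 ^ Suc (E (beta s) M)\<bar> \<le> (1/2) ^ M"
  shows "computable_real_map enc_str r"
proof -
  obtain g where g: "trec g" "\<And>s. g (enc_str s) = beta s" using ex_trec_beta by blast
  let ?q = "\<lambda>(s, M). Fract (int (2 * X (beta s) M + 1)) (2 ^ Suc (E (beta s) M))"
  have "recursive_map (enc_pair enc_str enc_nat) enc_rat ?q"
  proof (rule recursive_map_pairI)
    show "trec (\<lambda>z. prod_encode (2 * (2 * X (g (pfst z)) (psnd z) + 1), 2 ^ Suc (E (g (pfst z)) (psnd z))))"
      by (intro trec_intros trec_comp2[OF X] trec_comp2[OF E] trec_comp[OF g(1)])
  qed (use enc_rat_odd_dyadic g(2) in \<open>simp add: enc_nat_def\<close>)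
  moreover have "real_of_rat (?q (s, M)) = (2 * real (X (beta s) M) + 1) / 2 ^ Suc (E (beta s) M)" for s M
    by (simp add: Fract_of_int_quotient of_rat_divide of_rat_add of_rat_mult of_rat_power)
  ultimately show ?thesis
    unfolding computable_real_map_def using approx by (intro exI[of _ ?q] conjI allI) simp_all
qed

section \<open>Backward recursion on the binary tree\<close>

text \<open>The children \<open>2 * b\<close> and \<open>Suc (2 * b)\<close> of a node have larger
  numbers. Visiting the nodes in decreasing order and keeping the list of all values so far turns
  the recursion into \<open>rec_nat\<close>.\<close>

lemma trec_tree_recursion:
  assumes B: "trec B"
    and leaf: "trec (\<lambda>z. leaf (pfst z) (psnd z))"
    and comb: "trec (\<lambda>z. comb (pfst z) (pfst (psnd z)) (pfst (psnd (psnd z))) (psnd (psnd (psnd z))))"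
  obtains v where "trec (\<lambda>z. v (pfst z) (psnd z))"
    and "\<And>N b. 2 ^ B N \<le> b \<Longrightarrow> v N b = leaf N b"
    and "\<And>N b. 0 < b \<Longrightarrow> b < 2 ^ B N \<Longrightarrow> v N b = comb N b (v N (2 * b)) (v N (Suc (2 * b)))"
proof -
  define tl where "tl c = rec_nat c (\<lambda>_ c. psnd (c - 1))" for c :: nat
  define nth where "nth c k = pfst (tl c k - 1)" for c k
  \<comment> \<open>Time \<open>i\<close> treats the node \<open>b = 2 * 2 ^ B N - 1 - i\<close>,
    starting from the last leaf. Its children were treated \<open>b\<close> and \<open>b + 1\<close>
    times earlier, so they sit at positions \<open>b - 1\<close> and \<open>b\<close> of the
    history, whose head is the newest value.\<close>
  define H where "H N i c = (let b = 2 * 2 ^ B N - 1 - i in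
      if 2 ^ B N \<le> b then leaf N b else comb N b (nth c (b - 1)) (nth c b))" for N i c
  define hist where "hist N = rec_nat 0 (\<lambda>i c. Suc (prod_encode (H N i c, c)))" for N
  define f where "f N i = H N i (hist N i)" for N i
  \<comment> \<open>Below the leaves the truncated subtraction would send every node to time 0, so
    \<open>leaf\<close> is used directly there.\<close>
  define v where "v N b = (if 2 ^ B N \<le> b then leaf N b else f N (2 * 2 ^ B N - 1 - b))" for N b
  have tl_hist: "tl (hist N i) k = hist N (i - k)" if "k \<le> i" for N i k
    using that
  proof (induction k)
    case 0
    then show ?case by (simp add: tl_def)
  next
    case (Suc k)
    then have "i - k = Suc (i - Suc k)" by simp
    then have "hist N (i - k) = Suc (prod_encode (H N (i - Suc k) (hist N (i - Suc k)), hist N (i - Suc k)))"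
      by (simp add: hist_def)
    then show ?case using Suc by (simp add: tl_def)
  qed
  have nth_hist: "nth (hist N i) k = f N (i - Suc k)" if "k < i" for N i k
  proof -
    have "i - k = Suc (i - Suc k)" using that by simp
    then have "hist N (i - k) = Suc (prod_encode (f N (i - Suc k), hist N (i - Suc k)))"
      by (simp add: hist_def f_def)
    then show ?thesis using that by (simp add: nth_def tl_hist)
  qed
  have v_f: "v N b = f N (2 * 2 ^ B N - 1 - b)" if "b < 2 * 2 ^ B N" for N b
    using that by (simp add: v_def f_def H_def)
  have "v N b = comb N b (v N (2 * b)) (v N (Suc (2 * b)))" if "0 < b" "b < 2 ^ B N" for N b
  proof -
    let ?i = "2 * 2 ^ B N - 1 - b"
    have i: "2 * 2 ^ B N - 1 - ?i = b" using that by simp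
    have "v N b = comb N b (nth (hist N ?i) (b - 1)) (nth (hist N ?i) b)"
      using that i by (simp add: v_def f_def H_def)
    moreover have "nth (hist N ?i) (b - 1) = v N (2 * b)"
    proof -
      have "?i - Suc (b - 1) = 2 * 2 ^ B N - 1 - 2 * b" using that by simp
      moreover have "b - 1 < ?i" using that by linarith
      ultimately show ?thesis using v_f[of "2 * b" N] that nth_hist[of "b - 1" ?i N] by simp
    qed
    moreover have "nth (hist N ?i) b = v N (Suc (2 * b))"
    proof -
      have "?i - Suc b = 2 * 2 ^ B N - 1 - Suc (2 * b)" using that by simp
      moreover have "b < ?i" using that by linarith
      moreover have "Suc (2 * b) < 2 * 2 ^ B N" using that by linarith
      ultimately show ?thesis using v_f[of "Suc (2 * b)" N] nth_hist[of b ?i N] by simp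
    qed
    ultimately show ?thesis by simp
  qed
  moreover have "trec (\<lambda>z. v (pfst z) (psnd z))"
  proof -
    have comb': "trec (\<lambda>x. comb (p x) (q x) (r x) (s x))"
      if "trec p" "trec q" "trec r" "trec s" for p q r s
      using trec_comp[OF comb trec_prod_encode[OF that(1) trec_prod_encode[OF that(2)
            trec_prod_encode[OF that(3,4)]]]] by simp
    have nth': "trec (\<lambda>x. nth (p x) (q x))" if "trec p" "trec q" for p q
      unfolding nth_def tl_def by (intro trec_intros trec_rec_nat that)
    have H': "trec (\<lambda>x. H (p x) (q x) (r x))" if "trec p" "trec q" "trec r" for p q r
      unfolding H_def Let_def
      by (intro trec_intros trec_comp[OF B] trec_comp2[OF leaf] comb' nth' that)
    have hist': "trec (\<lambda>x. hist (p x) (q x))" if "trec p" "trec q" for p q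
      unfolding hist_def by (intro trec_intros trec_rec_nat H' trec_comp[OF that(1)] that)
    show ?thesis
      unfolding v_def f_def
      by (intro trec_intros trec_comp[OF B] trec_comp2[OF leaf] H' hist')
  qed
  ultimately show thesis using that[of v] by (auto simp: v_def)
qed

section \<open>Supermartingales and upper probabilities\<close>

lemma forecast_interval:
  assumes "forecasting_system \<phi>"
  shows "\<phi> s = {lower_fc \<phi> s..upper_fc \<phi> s}" "0 \<le> lower_fc \<phi> s"
    "lower_fc \<phi> s \<le> upper_fc \<phi> s" "upper_fc \<phi> s \<le> 1"
proof -
  obtain a b where ab: "0 \<le> a" "a \<le> b" "b \<le> 1" "\<phi> s = {a..b}"
    using assms unfolding forecasting_system_def closed_subinterval_def by blast
  then have "lower_fc \<phi> s = a" "upper_fc \<phi> s = b"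
    by (simp_all add: lower_fc_def upper_fc_def)
  then show "\<phi> s = {lower_fc \<phi> s..upper_fc \<phi> s}" "0 \<le> lower_fc \<phi> s"
    "lower_fc \<phi> s \<le> upper_fc \<phi> s" "upper_fc \<phi> s \<le> 1"
    using ab by simp_all
qed

text \<open>The mixture is affine in \<open>p\<close>, hence largest at one of the endpoints,
  depending on the sign of \<open>a - b\<close>.\<close>

lemma mix_le_endpoints:
  fixes p :: real
  assumes "l \<le> p" "p \<le> u" "l * a + (1 - l) * b \<le> c" "u * a + (1 - u) * b \<le> c"
  shows "p * a + (1 - p) * b \<le> c"
proof (cases "b \<le> a")
  case True
  then have "p * (a - b) \<le> u * (a - b)" using assms by (intro mult_right_mono) auto
  then show ?thesis using assms by (simp add: algebra_simps)
next
  case False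
  then have "p * (a - b) \<le> l * (a - b)" using assms by (intro mult_right_mono_neg) auto
  then show ?thesis using assms by (simp add: algebra_simps)
qed

text \<open>Replaces the supremum over the forecast interval by two linear inequalities; all later
  work with supermartingales uses this form.\<close>

lemma supermartingale_iff:
  assumes "forecasting_system \<phi>"
  shows "supermartingale \<phi> M \<longleftrightarrow> (\<forall>s. \<forall>p \<in> {lower_fc \<phi> s, upper_fc \<phi> s}.
    p * M (s @ [True]) + (1 - p) * M (s @ [False]) \<le> M s)"
proof -
  have "upper_exp (\<phi> s) (\<lambda>x. M (s @ [x])) \<le> c \<longleftrightarrow> (\<forall>p \<in> {lower_fc \<phi> s, upper_fc \<phi> s}.
    p * M (s @ [True]) + (1 - p) * M (s @ [False]) \<le> c)" (is "?L \<longleftrightarrow> ?R") for s c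
  proof -
    note I = forecast_interval[OF assms, of s]
    let ?g = "\<lambda>p. p * M (s @ [True]) + (1 - p) * M (s @ [False])"
    have "compact (?g ` \<phi> s)"
      unfolding I(1) by (intro compact_continuous_image continuous_intros) auto
    then have "bdd_above (?g ` \<phi> s)" by (intro bounded_imp_bdd_above compact_imp_bounded)
    moreover have "\<phi> s \<noteq> {}" using I by auto
    ultimately have "?L \<longleftrightarrow> (\<forall>p\<in>\<phi> s. ?g p \<le> c)"
      unfolding upper_exp_def by (subst cSup_le_iff) auto
    also have "\<dots> \<longleftrightarrow> ?R"
    proof
      assume "\<forall>p\<in>\<phi> s. ?g p \<le> c"
      moreover have "{lower_fc \<phi> s, upper_fc \<phi> s} \<subseteq> \<phi> s" using I(3) by (subst I(1)) simp
      ultimately show ?R by blast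
    next
      assume R: ?R
      show "\<forall>p\<in>\<phi> s. ?g p \<le> c"
      proof
        fix p assume "p \<in> \<phi> s"
        then have "lower_fc \<phi> s \<le> p" "p \<le> upper_fc \<phi> s" using I(1) by auto
        then show "?g p \<le> c" using R by (intro mix_le_endpoints[of "lower_fc \<phi> s" p "upper_fc \<phi> s"]) auto
      qed
    qed
    finally show ?thesis .
  qed
  then show ?thesis unfolding supermartingale_def by blast
qed

lemma upper_prob_le:
  assumes "supermartingale \<phi> M"
    and "\<And>\<omega>. ereal (indicator G \<omega>) \<le> liminf (\<lambda>n. ereal (M (prefix \<omega> n)))"
  shows "upper_prob \<phi> G \<le> ereal (M [])"
  unfolding upper_prob_def using assms by (intro Inf_lower) blast

lemma length_prefix [simp]: "length (prefix \<omega> n) = n"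
  by (simp add: prefix_def)

lemma take_prefix: "k \<le> n \<Longrightarrow> take k (prefix \<omega> n) = prefix \<omega> k"
  by (simp add: prefix_def take_map)

lemma prefix_Suc: "prefix \<omega> (Suc n) = prefix \<omega> n @ [\<omega> n]"
  by (simp add: prefix_def)

section \<open>Stopping at the first entry into a set, and Ville's inequality\<close>

definition stopped :: "sit set \<Rightarrow> sit \<Rightarrow> sit" where
  "stopped B s = (if \<exists>i\<le>length s. take i s \<in> B then take (LEAST i. take i s \<in> B) s else s)"

lemma stopped_mem: "i \<le> length s \<Longrightarrow> take i s \<in> B \<Longrightarrow> stopped B s \<in> B"
  unfolding stopped_def by (auto intro: LeastI)

text \<open>The dichotomy that makes a stopped supermartingale a supermartingale: after the entry it
  is constant, before it the original inequality applies.\<close>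

lemma stopped_snoc:
  "stopped B (s @ [x]) = (if \<exists>i\<le>length s. take i s \<in> B then stopped B s else s @ [x])"
proof (cases "\<exists>i\<le>length s. take i s \<in> B")
  case True
  then obtain i where i: "i \<le> length s" "take i s \<in> B" by blast
  let ?k = "LEAST i. take i s \<in> B"
  have k: "?k \<le> length s" using Least_le[of "\<lambda>i. take i s \<in> B", OF i(2)] i(1) by linarith
  have kB: "take ?k s \<in> B" using i(2) by (rule LeastI)
  have "(LEAST i. take i (s @ [x]) \<in> B) = ?k"
  proof (rule Least_equality)
    show "take ?k (s @ [x]) \<in> B" using k kB by simp
    fix j assume j: "take j (s @ [x]) \<in> B"
    show "?k \<le> j"
    proof (cases "j \<le> length s")
      case True
      then show ?thesis using j by (intro Least_le) simp
    qed (use k in linarith)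
  qed
  moreover have "take i (s @ [x]) \<in> B" "i \<le> length (s @ [x])" using i by simp_all
  ultimately have "stopped B (s @ [x]) = take ?k (s @ [x])" unfolding stopped_def by auto
  also have "\<dots> = stopped B s" using k True unfolding stopped_def by simp
  finally show ?thesis using True by simp
next
  case False
  have "stopped B (s @ [x]) = s @ [x]"
  proof (cases "\<exists>i\<le>length (s @ [x]). take i (s @ [x]) \<in> B")
    case True
    let ?k = "LEAST i. take i (s @ [x]) \<in> B"
    have "take ?k (s @ [x]) \<in> B" using True by (auto intro: LeastI)
    then have "\<not> ?k \<le> length s" using False by auto
    then have "take ?k (s @ [x]) = s @ [x]" by simp
    then show ?thesis using True unfolding stopped_def by simp
  next
    case False
    then show ?thesis unfolding stopped_def by (rule if_not_P)
  qed
  then show ?thesis using False by (simp only: if_False)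
qed

text \<open>Ville's inequality: stop betting as soon as the capital reaches \<open>c\<close>.\<close>

lemma upper_prob_ville:
  assumes \<phi>: "forecasting_system \<phi>" and T: "test_supermartingale \<phi> T"
    and c: "0 < c" "\<And>s. s \<in> B \<Longrightarrow> c \<le> T s" and G: "G \<subseteq> cylset B"
  shows "upper_prob \<phi> G \<le> ereal (1 / c)"
proof -
  let ?M = "\<lambda>s. T (stopped B s) / c"
  have T': "supermartingale \<phi> T" "\<And>s. 0 \<le> T s" "T [] = 1"
    using T unfolding test_supermartingale_def by auto
  have "supermartingale \<phi> ?M"
    unfolding supermartingale_iff[OF \<phi>]
  proof (intro allI ballI)
    fix s p assume p: "p \<in> {lower_fc \<phi> s, upper_fc \<phi> s}"
    show "p * ?M (s @ [True]) + (1 - p) * ?M (s @ [False]) \<le> ?M s"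
    proof (cases "\<exists>i\<le>length s. take i s \<in> B")
      case True
      then have "?M (s @ [x]) = ?M s" for x by (simp add: stopped_snoc)
      moreover have "p * y + (1 - p) * y \<le> y" for y :: real by (simp add: algebra_simps)
      ultimately show ?thesis by (simp only:)
    next
      case False
      then have "stopped B s = s" by (auto simp: stopped_def)
      moreover have "p * T (s @ [True]) + (1 - p) * T (s @ [False]) \<le> T s"
        using T'(1) p unfolding supermartingale_iff[OF \<phi>] by blast
      moreover have "stopped B (s @ [x]) = s @ [x]" for x
        unfolding stopped_snoc using False by (rule if_not_P)
      ultimately show ?thesis
        using c(1) by (simp add: divide_right_mono flip: add_divide_distrib)
    qed
  qed
  moreover have "ereal (indicator G \<omega>) \<le> liminf (\<lambda>n. ereal (?M (prefix \<omega> n)))" for \<omega>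
  proof (rule Liminf_bounded)
    show "\<forall>\<^sub>F n in sequentially. ereal (indicator G \<omega>) \<le> ereal (?M (prefix \<omega> n))"
    proof (cases "\<omega> \<in> G")
      case True
      then obtain t where t: "t \<in> B" "prefix \<omega> (length t) = t"
        using G unfolding cylset_def cyl_def by auto
      have "1 \<le> ?M (prefix \<omega> n)" if "length t \<le> n" for n
      proof -
        have "stopped B (prefix \<omega> n) \<in> B"
          using that t by (intro stopped_mem[of "length t"]) (simp_all add: take_prefix)
        then show ?thesis using c by simp
      qed
      then show ?thesis using True by (auto simp: eventually_sequentially)
    next
      case False
      then show ?thesis using T'(2) c(1) by simp
    qed
  qed
  ultimately have "upper_prob \<phi> G \<le> ereal (?M [])" by (rule upper_prob_le)
  moreover have "stopped B [] = []" unfolding stopped_def by (simp only: take_Nil if_cancel)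
  ultimately show ?thesis using T'(3) by simp
qed

section \<open>From limits along paths to values at situations\<close>

text \<open>Against a supermartingale there is always an outcome that does not increase the capital.\<close>

lemma supermartingale_path:
  assumes \<phi>: "forecasting_system \<phi>" and M: "supermartingale \<phi> M"
  obtains \<omega> where "\<omega> \<in> cyl s" and "\<And>n. length s \<le> n \<Longrightarrow> M (prefix \<omega> n) \<le> M s"
proof -
  have "\<exists>x. M (t @ [x]) \<le> M t" for t
  proof (rule ccontr)
    assume "\<nexists>x. M (t @ [x]) \<le> M t"
    then have gt: "M t < M (t @ [x])" for x by (auto simp: not_le)
    let ?p = "lower_fc \<phi> t"
    have p: "0 \<le> ?p" "?p \<le> 1" using forecast_interval[OF \<phi>, of t] by auto
    have "?p * M (t @ [True]) + (1 - ?p) * M (t @ [False]) \<le> M t"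
      using M unfolding supermartingale_iff[OF \<phi>] by blast
    moreover have "M t < ?p * M (t @ [True]) + (1 - ?p) * M (t @ [False])"
      using convex_bound_lt[of "- M (t @ [True])" "- M t" "- M (t @ [False])" ?p "1 - ?p"] gt p
      by simp
    ultimately show False by linarith
  qed
  then obtain x where x: "\<And>t. M (t @ [x t]) \<le> M t" by metis
  define u where "u = rec_nat s (\<lambda>_ t. t @ [x t])"
  define \<omega> where "\<omega> n = (if n < length s then s ! n else x (u (n - length s)))" for n
  have u: "prefix \<omega> (length s + n) = u n \<and> M (u n) \<le> M s" for n
  proof (induction n)
    case 0
    show ?case by (auto simp: u_def prefix_def \<omega>_def intro: nth_equalityI)
  next
    case (Suc n)
    then show ?case using x[of "u n"] by (auto simp: prefix_Suc u_def \<omega>_def)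
  qed
  show thesis
  proof (rule that[of \<omega>])
    show "\<omega> \<in> cyl s" using u[of 0] by (simp add: cyl_def u_def)
    show "M (prefix \<omega> n) \<le> M s" if "length s \<le> n" for n
      using u[of "n - length s"] that by simp
  qed
qed

text \<open>Along a path through \<open>s\<close> on which \<open>M\<close> never exceeds
  \<open>M s\<close>, the liminf is at most \<open>M s\<close>. So the limit condition on a
  competitor in \<open>upper_prob\<close> already constrains its values at situations, as needed at
  the leaves of the backward recursion.\<close>

lemma indicator_le_supermartingale:
  assumes \<phi>: "forecasting_system \<phi>" and M: "supermartingale \<phi> M"
    and lim: "\<And>\<omega>. ereal (indicator G \<omega>) \<le> liminf (\<lambda>n. ereal (M (prefix \<omega> n)))"
  shows "0 \<le> M s" and "cyl s \<subseteq> G \<Longrightarrow> 1 \<le> M s"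
proof -
  obtain \<omega> where \<omega>: "\<omega> \<in> cyl s" "\<And>n. length s \<le> n \<Longrightarrow> M (prefix \<omega> n) \<le> M s"
    using supermartingale_path[OF \<phi> M] by blast
  have "ereal (indicator G \<omega>) \<le> liminf (\<lambda>n. ereal (M (prefix \<omega> n)))" by (rule lim)
  also have "\<dots> \<le> limsup (\<lambda>n. ereal (M (prefix \<omega> n)))" by (rule Liminf_le_Limsup) simp
  also have "\<dots> \<le> ereal (M s)"
    using \<omega>(2) by (intro Limsup_bounded) (auto simp: eventually_sequentially)
  finally have *: "indicator G \<omega> \<le> M s" by simp
  then show "0 \<le> M s" by (cases "\<omega> \<in> G") auto
  show "1 \<le> M s" if "cyl s \<subseteq> G" using * \<omega>(1) that by (cases "\<omega> \<in> G") auto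
qed

section \<open>Schnorr test randomness implies Schnorr randomness\<close>

lemma growth_function_trec: "growth_function \<rho> \<Longrightarrow> trec \<rho>"
  unfolding growth_function_def using trec_recursive_map[of enc_nat enc_nat \<rho> "\<lambda>x. x"]
  by (simp add: enc_nat_def trec_id)

lemma schnorr_test_of_supermartingale:
  assumes \<phi>: "forecasting_system \<phi>" and T: "test_supermartingale \<phi> T"
    and comp: "computable_real_map enc_str T" and \<rho>: "growth_function \<rho>"
  obtains A where "schnorr_test \<phi> A"
    and "\<And>\<omega>. \<exists>\<^sub>F n in sequentially. real (\<rho> n) < T (prefix \<omega> n) \<Longrightarrow> \<omega> \<in> (\<Inter>n. cylset (level A n))"
proof -
  have T': "\<And>s. 0 \<le> T s" using T unfolding test_supermartingale_def by auto
  have \<rho>': "trec \<rho>" "mono \<rho>" "\<And>m. \<exists>n. m \<le> \<rho> n"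
    using \<rho> growth_function_trec unfolding growth_function_def by auto
  obtain Q where Q: "trec (\<lambda>z. Q (pfst z) (psnd z))"
    and Q_le: "\<And>b J. real (Q b J) \<le> 2 ^ J * T (str_of b) + 1"
    and Q_ge: "\<And>b J. 2 ^ J * T (str_of b) \<le> real (Q b J) + 2"
    using computable_real_map_approx[OF comp T'] by blast
  \<comment> \<open>Precision 0 is enough. The \<open>+ 2\<close> lets every \<open>s\<close> with
    \<open>\<rho> (length s) < T s\<close> pass the second test; passing it gives
    \<open>T s \<ge> \<rho> (length s) - 3\<close>, and the \<open>+ 3\<close> compensates for
    this.\<close>
  define A where "A = {(n, s). 2 ^ n + 3 \<le> \<rho> (length s) \<and> \<rho> (length s) \<le> Q (beta s) 0 + 2}"
  have A_ge: "2 ^ k \<le> T s" if "s \<in> level A n" "2 ^ k + 3 \<le> \<rho> (length s)" for k n s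
  proof -
    have "real (2 ^ k + 3) \<le> real (Q (beta s) 0 + 2)"
      using that unfolding A_def level_def by (simp only: of_nat_le_iff) auto
    then show ?thesis using Q_le[of "beta s" 0] by simp
  qed
  have rec: "recursive_set (enc_pair enc_nat enc_str) A"
  proof -
    obtain g where g: "trec g" "\<And>s. g (enc_str s) = beta s" using ex_trec_beta by blast
    show ?thesis unfolding recursive_set_def
    proof (rule recursive_map_pairI)
      have "dec (\<lambda>z. 2 ^ pfst z + 3 \<le> \<rho> (length (str_of (g (psnd z)))) \<and>
          \<rho> (length (str_of (g (psnd z)))) \<le> Q (g (psnd z)) 0 + 2)"
        by (intro trec_intros trec_comp[OF \<rho>'(1)] trec_comp[OF g(1)] trec_comp2[OF Q]
            trec_length_str_of)
      then show "trec (\<lambda>z. of_bool (2 ^ pfst z + 3 \<le> \<rho> (length (str_of (g (psnd z)))) \<and>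
          \<rho> (length (str_of (g (psnd z)))) \<le> Q (g (psnd z)) 0 + 2))"
        unfolding dec_def .
    qed (auto simp: enc_nat_def enc_bool_def A_def g(2))
  qed
  \<comment> \<open>Used twice: \<open>k = n\<close> bounds the level itself, \<open>k = N\<close>
    its tail.\<close>
  have ville: "upper_prob \<phi> G \<le> ereal ((1/2) ^ k)"
    if "G \<subseteq> cylset {s \<in> level A n. 2 ^ k + 3 \<le> \<rho> (length s)}" for G k n
    using upper_prob_ville[OF \<phi> T, of "2 ^ k" "{s \<in> level A n. 2 ^ k + 3 \<le> \<rho> (length s)}" G]
      A_ge that by (auto simp: power_one_over)
  have "upper_prob \<phi> (cylset (level A n)) \<le> ereal ((1/2) ^ n)" for n
    by (rule ville[where n = n and k = n]) (auto simp: cylset_def level_def A_def)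
  moreover
  \<comment> \<open>From this length on, membership in any level forces
    \<open>T s \<ge> 2 ^ N\<close>.\<close>
  define e where "e = (\<lambda>(N, n :: nat). LEAST l. 2 ^ N + 3 \<le> \<rho> l)"
  have "recursive_map (enc_pair enc_nat enc_nat) enc_nat e"
  proof (rule recursive_map_pairI)
    show "trec (\<lambda>z. LEAST l. 2 ^ pfst z + 3 \<le> \<rho> l)"
      using \<rho>'(3) by (intro trec_Least trec_intros trec_comp[OF \<rho>'(1)])
  qed (auto simp: e_def enc_nat_def)
  moreover have "upper_prob \<phi> (cylset (level A n) - cylset (level_below A n l)) \<le> ereal ((1/2) ^ N)"
    if "e (N, n) \<le> l" for N n l
  proof (rule ville[where n = n and k = N])
    have "2 ^ N + 3 \<le> \<rho> (e (N, n))"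
      unfolding e_def using LeastI_ex[OF \<rho>'(3)] by simp
    then have "2 ^ N + 3 \<le> \<rho> k" if "l \<le> k" for k
      using monoD[OF \<rho>'(2), of "e (N, n)" k] \<open>e (N, n) \<le> l\<close> that by linarith
    then show "cylset (level A n) - cylset (level_below A n l)
        \<subseteq> cylset {s \<in> level A n. 2 ^ N + 3 \<le> \<rho> (length s)}"
      unfolding cylset_def level_below_def by (auto simp: not_less) (meson not_less)
  qed
  ultimately have "schnorr_test \<phi> A"
    unfolding schnorr_test_def using rec by blast
  moreover have "\<omega> \<in> cylset (level A n)"
    if freq: "\<exists>\<^sub>F n in sequentially. real (\<rho> n) < T (prefix \<omega> n)" for \<omega> n
  proof -
    obtain k where k: "2 ^ n + 3 \<le> \<rho> k" using \<rho>'(3) by blast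
    obtain m where m: "k \<le> m" "real (\<rho> m) < T (prefix \<omega> m)"
      using freq unfolding frequently_sequentially by blast
    have "2 ^ n + 3 \<le> \<rho> m" using monoD[OF \<rho>'(2) m(1)] k by linarith
    moreover have "real (\<rho> m) < real (Q (beta (prefix \<omega> m)) 0 + 2)"
      using m(2) Q_ge[of 0 "beta (prefix \<omega> m)"] by simp
    ultimately have "prefix \<omega> m \<in> level A n"
      by (simp add: level_def A_def)
    then show ?thesis unfolding cylset_def cyl_def by (rule UN_I) simp
  qed
  ultimately show thesis using that by blast
qed

lemma schnorr_test_random_imp_schnorr_random:
  assumes "forecasting_system \<phi>" and "schnorr_test_random \<phi> \<omega>"
  shows "schnorr_random \<phi> \<omega>"
  unfolding schnorr_random_def
proof (intro allI impI)
  fix T \<rho>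
  assume *: "test_supermartingale \<phi> T \<and> computable_real_map enc_str T \<and> growth_function \<rho>"
  then obtain A where A: "schnorr_test \<phi> A"
    "\<exists>\<^sub>F n in sequentially. real (\<rho> n) < T (prefix \<omega> n) \<Longrightarrow> \<omega> \<in> (\<Inter>n. cylset (level A n))"
    using schnorr_test_of_supermartingale[OF assms(1)] by metis
  then have "\<not> (\<exists>\<^sub>F n in sequentially. real (\<rho> n) < T (prefix \<omega> n))"
    using assms(2) unfolding schnorr_test_random_def by blast
  then have "\<forall>\<^sub>F n in sequentially. ereal (T (prefix \<omega> n) - real (\<rho> n)) \<le> 0"
    by (simp add: not_frequently not_less)
  then show "limsup (\<lambda>n. ereal (T (prefix \<omega> n) - real (\<rho> n))) \<le> 0"
    by (rule Limsup_bounded)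
qed

section \<open>Schnorr randomness implies Schnorr test randomness\<close>

lemma mix_add: "p * (x + d) + (1 - p) * (y + d) = (p * x + (1 - p) * y) + d" for p :: real
  by (simp add: algebra_simps)

text \<open>One step of the recursion on numerators over \<open>R\<close>. Widening the forecasts
  and rounding up preserve the supermartingale inequality; the cap at \<open>2 ^ J\<close> does too,
  as mixtures of values up to 1 stay up to 1. The forecasts are off by at most \<open>3 / R\<close>
  and values lie in the unit interval, so they cost \<open>3 / R\<close>; rounding costs
  \<open>1 / R\<close>, in total \<open>4 / R\<close>.\<close>

lemma rounded_mix_bounds:
  fixes lo hi :: real and J y0 y1 pl ph :: nat
  defines "R \<equiv> 2 ^ J :: real"
  defines "w \<equiv> min (2 ^ J)
    (max (pl * y1 + (2 ^ J - pl) * y0) (ph * y1 + (2 ^ J - ph) * y0) div 2 ^ J + 1)"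
  assumes y: "y0 \<le> 2 ^ J" "y1 \<le> 2 ^ J" and p: "0 \<le> lo" "lo \<le> hi" "hi \<le> 1"
    and pl: "real pl \<le> R * lo" "R * lo \<le> real pl + 3"
    and ph: "R * hi \<le> real ph" "real ph \<le> R * hi + 3" "ph \<le> 2 ^ J"
  shows "p \<in> {lo, hi} \<Longrightarrow> p * (real y1 / R) + (1 - p) * (real y0 / R) \<le> real w / R"
    and "(\<And>p. p \<in> {lo, hi} \<Longrightarrow> p * (real y1 / R) + (1 - p) * (real y0 / R) \<le> c) \<Longrightarrow>
      real w / R \<le> c + 4 / R"
proof -
  define X where "X = max (pl * y1 + (2 ^ J - pl) * y0) (ph * y1 + (2 ^ J - ph) * y0)"
  define a b Y0 Y1 where "a = real pl / R" and "b = real ph / R" and "Y0 = real y0 / R"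
    and "Y1 = real y1 / R"
  have R: "0 < R" by (simp add: R_def)
  have RJ: "R = real (2 ^ J)" by (simp add: R_def)
  have "R * lo \<le> R" using p R by simp
  then have "real pl \<le> real (2 ^ J)" using pl(1) unfolding RJ[symmetric] by linarith
  then have pl': "pl \<le> 2 ^ J" by (simp only: of_nat_le_iff)
  have mix: "real (q * y1 + (2 ^ J - q) * y0) / R / R = real q / R * Y1 + (1 - real q / R) * Y0"
    if "q \<le> 2 ^ J" for q
  proof -
    have "real (q * y1 + (2 ^ J - q) * y0) = real q * real y1 + (R - real q) * real y0"
      using that by (simp add: R_def of_nat_diff)
    then show ?thesis using R by (simp add: Y0_def Y1_def field_simps)
  qed
  have X: "real X / R / R = max (a * Y1 + (1 - a) * Y0) (b * Y1 + (1 - b) * Y0)"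
  proof -
    have "real X / R / R = max (real (pl * y1 + (2 ^ J - pl) * y0) / R / R)
        (real (ph * y1 + (2 ^ J - ph) * y0) / R / R)"
      using R unfolding X_def by (simp add: max_def divide_le_cancel del: of_nat_add of_nat_mult)
    then show ?thesis unfolding mix[OF pl'] mix[OF ph(3)] a_def b_def .
  qed
  have a: "a \<le> lo" "lo \<le> a + 3 / R" and b: "hi \<le> b" "b \<le> hi + 3 / R"
    using pl ph R by (simp_all add: a_def b_def field_simps)
  have Y: "0 \<le> Y0" "Y0 \<le> 1" "0 \<le> Y1" "Y1 \<le> 1"
    using y R by (simp_all add: Y0_def Y1_def R_def)
  have wX: "w = min (2 ^ J) (X div 2 ^ J + 1)" by (simp add: w_def X_def)
  have lo_X: "real X / R / R \<le> real (X div 2 ^ J + 1) / R"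
    using real_div_less_nat_div[of "2 ^ J" X] R unfolding RJ
    by (intro divide_right_mono) (simp_all add: add.commute)
  have w_min: "real w / R = min 1 (real (X div 2 ^ J + 1) / R)"
  proof -
    have "real w = min R (real (X div 2 ^ J + 1))" unfolding wX RJ by (rule of_nat_min)
    moreover have "min R y / R = min 1 (y / R)" for y using R by (auto simp: min_def divide_simps)
    ultimately show ?thesis by simp
  qed
  show "p * (real y1 / R) + (1 - p) * (real y0 / R) \<le> real w / R" if "p \<in> {lo, hi}" for p
  proof -
    have pp: "a \<le> p" "p \<le> b" "0 \<le> p" "p \<le> 1" using that a b p by auto
    have "p * Y1 + (1 - p) * Y0 \<le> real X / R / R"
      unfolding X using pp(1,2) by (rule mix_le_endpoints) auto
    moreover have "p * Y1 + (1 - p) * Y0 \<le> 1"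
      using convex_bound_le[of Y1 1 Y0 p "1 - p"] Y pp by simp
    ultimately show ?thesis
      unfolding w_min using lo_X by (simp add: Y0_def Y1_def)
  qed
  show "real w / R \<le> c + 4 / R"
    if c: "\<And>p. p \<in> {lo, hi} \<Longrightarrow> p * (real y1 / R) + (1 - p) * (real y0 / R) \<le> c"
  proof -
    have near: "q * Y1 + (1 - q) * Y0 \<le> c + 3 / R" if "\<bar>q - p\<bar> \<le> 3 / R" "p \<in> {lo, hi}" for p q
    proof -
      have "(q - p) * (Y1 - Y0) \<le> \<bar>q - p\<bar> * \<bar>Y1 - Y0\<bar>" by (metis abs_ge_self abs_mult)
      also have "\<dots> \<le> 3 / R * 1" using that Y R by (intro mult_mono) auto
      finally show ?thesis using c[OF that(2)] unfolding Y0_def[symmetric] Y1_def[symmetric]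
        by (simp add: algebra_simps)
    qed
    have "real X / R / R \<le> c + 3 / R"
      unfolding X using near[of a lo] near[of b hi] a b by auto
    moreover have "real (X div 2 ^ J + 1) / R \<le> (real X / R + 1) / R"
      using of_nat_div_le_of_nat[where ?'a = real, of X "2 ^ J"] R
      unfolding RJ by (intro divide_right_mono) simp_all
    ultimately have "real (X div 2 ^ J + 1) / R \<le> c + 4 / R"
      by (simp add: add_divide_distrib)
    then show ?thesis unfolding w_min by linarith
  qed
qed

lemma upper_prob_mono: "G \<subseteq> G' \<Longrightarrow> upper_prob \<phi> G \<le> upper_prob \<phi> G'"
proof -
  assume G: "G \<subseteq> G'"
  have "ereal (indicator G \<omega>) \<le> ereal (indicator G' \<omega>)" for \<omega>
    using G by (auto simp: indicator_def)
  then show ?thesis unfolding upper_prob_def by (intro Inf_superset_mono) (blast intro: order_trans)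
qed

lemma computable_fc_approx:
  assumes \<phi>: "forecasting_system \<phi>" "computable_fc \<phi>"
  obtains Ql Qh where "trec (\<lambda>z. Ql (pfst z) (psnd z))"
    and "\<And>b J. real (Ql b J) \<le> 2 ^ J * lower_fc \<phi> (str_of b) + 1"
    and "\<And>b J. 2 ^ J * lower_fc \<phi> (str_of b) \<le> real (Ql b J) + 2"
    and "trec (\<lambda>z. Qh (pfst z) (psnd z))"
    and "\<And>b J. real (Qh b J) \<le> 2 ^ J * upper_fc \<phi> (str_of b) + 1"
    and "\<And>b J. 2 ^ J * upper_fc \<phi> (str_of b) \<le> real (Qh b J) + 2"
proof -
  have nonneg: "0 \<le> lower_fc \<phi> s" "0 \<le> upper_fc \<phi> s" for s using forecast_interval(2,3)[OF \<phi>(1), of s] by auto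
  have comp: "computable_real_map enc_str (lower_fc \<phi>)" "computable_real_map enc_str (upper_fc \<phi>)"
    using \<phi>(2) unfolding computable_fc_def by auto
  obtain Ql where Ql: "trec (\<lambda>z. Ql (pfst z) (psnd z))"
    "\<And>b J. real (Ql b J) \<le> 2 ^ J * lower_fc \<phi> (str_of b) + 1"
    "\<And>b J. 2 ^ J * lower_fc \<phi> (str_of b) \<le> real (Ql b J) + 2"
    using computable_real_map_approx[OF comp(1) nonneg(1)] by blast
  obtain Qh where Qh: "trec (\<lambda>z. Qh (pfst z) (psnd z))"
    "\<And>b J. real (Qh b J) \<le> 2 ^ J * upper_fc \<phi> (str_of b) + 1"
    "\<And>b J. 2 ^ J * upper_fc \<phi> (str_of b) \<le> real (Qh b J) + 2"
    using computable_real_map_approx[OF comp(2) nonneg(2)] by blast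
  show thesis using that[OF Ql Qh] .
qed

text \<open>Real forecasts are replaced by dyadic outer approximations and prices are rounded up, so that
  the backward recursion for the price of a clopen event runs in the natural numbers.\<close>

lemma clopen_supermartingales:
  assumes \<phi>: "forecasting_system \<phi>" "computable_fc \<phi>" and B: "trec B"
    and D: "dec (\<lambda>z. D (pfst z) (str_of (psnd z)))" "\<And>N t. D N t \<Longrightarrow> length t < B N"
    and prob: "\<And>N. upper_prob \<phi> (cylset {t. D N t}) \<le> ereal ((1/2) ^ (2 * N + 2))"
  obtains v J where "trec (\<lambda>z. v (pfst z) (psnd z))" and "trec J" and "\<And>N. N \<le> J N"
    and "\<And>N. supermartingale \<phi> (\<lambda>s. real (v N (beta s)) / 2 ^ J N)"
    and "\<And>N. real (v N 1) / 2 ^ J N \<le> (1/2) ^ (2 * N + 1)"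
    and "\<And>N s i. B N \<le> length s \<Longrightarrow> i \<le> length s \<Longrightarrow> D N (take i s) \<Longrightarrow> v N (beta s) = 2 ^ J N"
proof -
  note I = forecast_interval[OF \<phi>(1)]
  obtain Ql Qh where Ql: "trec (\<lambda>z. Ql (pfst z) (psnd z))"
    "\<And>b J. real (Ql b J) \<le> 2 ^ J * lower_fc \<phi> (str_of b) + 1"
    "\<And>b J. 2 ^ J * lower_fc \<phi> (str_of b) \<le> real (Ql b J) + 2"
    and Qh: "trec (\<lambda>z. Qh (pfst z) (psnd z))"
    "\<And>b J. real (Qh b J) \<le> 2 ^ J * upper_fc \<phi> (str_of b) + 1"
    "\<And>b J. 2 ^ J * upper_fc \<phi> (str_of b) \<le> real (Qh b J) + 2"
    using computable_fc_approx[OF \<phi>] by blast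
  \<comment> \<open>There are \<open>B N\<close> levels with an error of \<open>4 / 2 ^ J N\<close>
    each; by \<open>B N \<le> 2 ^ B N\<close> the total is at most 2^-(2N+2).\<close>
  define J where "J N = B N + 2 * N + 4" for N
  \<comment> \<open>The shifts by 1 here and by 2 in \<open>ph\<close> cancel the slack of the
    approximations, giving a lower bound for the lower forecast and an upper bound for the upper
    one, each within 3 units.\<close>
  define pl where "pl N b = Ql b (J N) - 1" for N b
  define ph where "ph N b = min (2 ^ J N) (Qh b (J N) + 2)" for N b
  define hit where "hit N s \<longleftrightarrow> (\<exists>i\<le>length s. D N (take i s))" for N s
  define leaf where "leaf N b = (if hit N (str_of b) then 2 ^ J N else 0 :: nat)" for N b
  define comb where "comb N b y0 y1 = min (2 ^ J N)
    (max (pl N b * y1 + (2 ^ J N - pl N b) * y0) (ph N b * y1 + (2 ^ J N - ph N b) * y0) div 2 ^ J N + 1)"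
    for N b y0 y1 :: nat
  have J: "trec J" unfolding J_def by (intro trec_intros trec_comp[OF B])
  have "trec (\<lambda>z. leaf (pfst z) (psnd z))"
    unfolding leaf_def hit_def by (intro trec_intros dec_ex_prefix[OF D(1)] trec_comp[OF J])
  moreover have "trec (\<lambda>z. comb (pfst z) (pfst (psnd z)) (pfst (psnd (psnd z))) (psnd (psnd (psnd z))))"
    unfolding comb_def pl_def ph_def
    by (intro trec_intros trec_comp2[OF Ql(1)] trec_comp2[OF Qh(1)] trec_comp[OF J])
  ultimately obtain v where v: "trec (\<lambda>z. v (pfst z) (psnd z))"
    and v_leaf: "\<And>N b. 2 ^ B N \<le> b \<Longrightarrow> v N b = leaf N b"
    and v_comb: "\<And>N b. 0 < b \<Longrightarrow> b < 2 ^ B N \<Longrightarrow> v N b = comb N b (v N (2 * b)) (v N (Suc (2 * b)))"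
    using trec_tree_recursion[OF B] by blast
  define V where "V N s = real (v N (beta s)) / 2 ^ J N" for N s
  have V_leaf: "v N (beta s) = (if hit N s then 2 ^ J N else 0)" if "B N \<le> length s" for N s
    using that v_leaf[of N "beta s"] length_less_iff_beta[of s "B N"] by (simp add: leaf_def not_less)
  have V_comb: "v N (beta s) = comb N (beta s) (v N (beta (s @ [False]))) (v N (beta (s @ [True])))"
    if "length s < B N" for N s
    using that v_comb[of "beta s" N] length_less_iff_beta[of s "B N"] by simp
  have v_le: "v N (beta s) \<le> 2 ^ J N" for N s
    by (cases "length s < B N") (simp_all add: V_comb V_leaf comb_def)
  have pl: "real (pl N (beta s)) \<le> 2 ^ J N * lower_fc \<phi> s"
    "2 ^ J N * lower_fc \<phi> s \<le> real (pl N (beta s)) + 3" for N s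
  proof -
    let ?q = "Ql (beta s) (J N)" and ?r = "2 ^ J N * lower_fc \<phi> s"
    have q: "real ?q \<le> ?r + 1" "?r \<le> real ?q + 2"
      using Ql(2,3)[where b = "beta s" and J = "J N"] unfolding str_of_beta by auto
    have "0 \<le> ?r" using I(2)[of s] by simp
    moreover have "real (pl N (beta s)) = (if ?q = 0 then 0 else real ?q - 1)"
      unfolding pl_def by (simp add: of_nat_diff)
    ultimately show "real (pl N (beta s)) \<le> ?r" "?r \<le> real (pl N (beta s)) + 3"
      using q by (simp_all split: if_splits)
  qed
  have ph: "2 ^ J N * upper_fc \<phi> s \<le> real (ph N (beta s))"
    "real (ph N (beta s)) \<le> 2 ^ J N * upper_fc \<phi> s + 3" "ph N (beta s) \<le> 2 ^ J N" for N s
  proof -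
    let ?q = "Qh (beta s) (J N)" and ?r = "2 ^ J N * upper_fc \<phi> s"
    have q: "real ?q \<le> ?r + 1" "?r \<le> real ?q + 2"
      using Qh(2,3)[where b = "beta s" and J = "J N"] unfolding str_of_beta by auto
    have "?r \<le> 2 ^ J N" using I(4)[of s] by simp
    moreover have "real (ph N (beta s)) = min (2 ^ J N) (real ?q + 2)"
      unfolding ph_def of_nat_min by simp
    ultimately show "?r \<le> real (ph N (beta s))" "real (ph N (beta s)) \<le> ?r + 3"
      using q by linarith+
    show "ph N (beta s) \<le> 2 ^ J N" by (simp add: ph_def)
  qed
  note step = rounded_mix_bounds[OF v_le v_le I(2-4) pl ph]
  have V_super: "p * V N (s @ [True]) + (1 - p) * V N (s @ [False]) \<le> V N s"
    if "length s < B N" "p \<in> {lower_fc \<phi> s, upper_fc \<phi> s}" for N s p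
    unfolding V_def V_comb[OF that(1)] comb_def by (rule step(1)[OF that(2)])
  have V_near: "V N s \<le> c + 4 / 2 ^ J N" if "length s < B N"
    and "\<And>p. p \<in> {lower_fc \<phi> s, upper_fc \<phi> s} \<Longrightarrow>
      p * V N (s @ [True]) + (1 - p) * V N (s @ [False]) \<le> c" for N s c
    using that(2) unfolding V_def V_comb[OF that(1)] comb_def by (rule step(2))
  have sm: "supermartingale \<phi> (V N)" for N
    unfolding supermartingale_iff[OF \<phi>(1)]
  proof (intro allI ballI)
    fix s p assume p: "p \<in> {lower_fc \<phi> s, upper_fc \<phi> s}"
    show "p * V N (s @ [True]) + (1 - p) * V N (s @ [False]) \<le> V N s"
    proof (cases "length s < B N")
      case True
      then show ?thesis using p by (rule V_super)
    next
      case False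
      \<comment> \<open>All members of \<open>D N\<close> are shorter than \<open>B N\<close>, so
        nothing new is hit from that depth on and the price stays constant.\<close>
      have "hit N (s @ [x]) \<longleftrightarrow> hit N s" for x
      proof
        assume "hit N (s @ [x])"
        then obtain i where i: "i \<le> length (s @ [x])" "D N (take i (s @ [x]))"
          unfolding hit_def by blast
        have "i \<le> length s" using D(2)[OF i(2)] i(1) False by simp
        then show "hit N s" using i(2) unfolding hit_def by auto
      next
        assume "hit N s"
        then obtain i where "i \<le> length s" "D N (take i s)" unfolding hit_def by blast
        then show "hit N (s @ [x])" unfolding hit_def by (intro exI[of _ i]) simp
      qed
      then have "V N (s @ [x]) = V N s" for x
        using False unfolding V_def by (simp add: V_leaf del: beta_snoc)
      then show ?thesis using mix_add[of p 0 "V N s" 0] by simp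
    qed
  qed
  have "V N [] \<le> (1/2) ^ (2 * N + 1)" for N
  proof -
    let ?G = "cylset {t. D N t}"
    have V_le: "V N [] \<le> M [] + (1/2) ^ (2 * N + 2)"
      if M: "supermartingale \<phi> M"
        and lim: "\<And>\<omega>. ereal (indicator ?G \<omega>) \<le> liminf (\<lambda>n. ereal (M (prefix \<omega> n)))" for M
    proof -
      \<comment> \<open>Induction on the distance \<open>d\<close> to the leaves: there
        \<open>M\<close> dominates the indicator of the event, and each level upwards adds one
        rounding error.\<close>
      have "V N s \<le> M s + real d * (4 / 2 ^ J N)" if "length s + d = B N" for s d
        using that
      proof (induction d arbitrary: s)
        case 0
        show ?case
        proof (cases "hit N s")
          case True
          have "cyl s \<subseteq> ?G"
          proof
            fix \<omega> assume "\<omega> \<in> cyl s"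
            then have "prefix \<omega> (length s) = s" by (simp add: cyl_def)
            moreover obtain i where "i \<le> length s" "D N (take i s)"
              using True unfolding hit_def by blast
            ultimately have "prefix \<omega> i = take i s" "D N (take i s)" "length (take i s) = i"
              using take_prefix[of i "length s" \<omega>] by auto
            then show "\<omega> \<in> ?G" unfolding cylset_def cyl_def by (intro UN_I[of "take i s"]) auto
          qed
          then have "1 \<le> M s" by (rule indicator_le_supermartingale(2)[OF \<phi>(1) M lim])
          then show ?thesis using 0 True by (simp add: V_def V_leaf)
        next
          case False
          then show ?thesis using 0 indicator_le_supermartingale(1)[OF \<phi>(1) M lim, of s]
            by (simp add: V_def V_leaf)
        qed
      next
        case (Suc d)
        let ?\<delta> = "real d * (4 / 2 ^ J N)"
        have "V N s \<le> (M s + ?\<delta>) + 4 / 2 ^ J N"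
        proof (rule V_near)
          show "length s < B N" using Suc.prems by simp
          fix p assume p: "p \<in> {lower_fc \<phi> s, upper_fc \<phi> s}"
          then have p01: "0 \<le> p" "p \<le> 1" using I[of s] by auto
          have IH: "V N (s @ [x]) \<le> M (s @ [x]) + ?\<delta>" for x using Suc by simp
          have "p * V N (s @ [True]) + (1 - p) * V N (s @ [False]) \<le>
              p * (M (s @ [True]) + ?\<delta>) + (1 - p) * (M (s @ [False]) + ?\<delta>)"
            using p01 IH by (intro add_mono mult_left_mono) auto
          also have "\<dots> = (p * M (s @ [True]) + (1 - p) * M (s @ [False])) + ?\<delta>"
            by (rule mix_add)
          also have "\<dots> \<le> M s + ?\<delta>"
            using M p unfolding supermartingale_iff[OF \<phi>(1)] by (intro add_right_mono) blast
          finally show "p * V N (s @ [True]) + (1 - p) * V N (s @ [False]) \<le> M s + ?\<delta>" .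
        qed
        then show ?case by (simp add: algebra_simps add_divide_distrib)
      qed
      from this[of "[]" "B N"] have "V N [] \<le> M [] + real (B N) * (4 / 2 ^ J N)" by simp
      also have "real (B N) * (4 / 2 ^ J N) \<le> 2 ^ B N * (4 / 2 ^ J N)"
        using of_nat_less_two_power[of "B N", where ?'a = real]
        by (intro mult_right_mono) (auto simp: less_imp_le)
      also have "\<dots> = (1/2) ^ (2 * N + 2)"
        by (simp add: J_def power_add power_one_over field_simps)
      finally show ?thesis by simp
    qed
    have "ereal (V N [] - (1/2) ^ (2 * N + 2)) \<le> upper_prob \<phi> ?G"
      unfolding upper_prob_def
    proof (rule Inf_greatest)
      fix x assume "x \<in> {ereal (M []) |M. supermartingale \<phi> M \<and>
        (\<forall>\<omega>. ereal (indicator ?G \<omega>) \<le> liminf (\<lambda>n. ereal (M (prefix \<omega> n))))}"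
      then obtain M where M: "x = ereal (M [])" "supermartingale \<phi> M"
        "\<And>\<omega>. ereal (indicator ?G \<omega>) \<le> liminf (\<lambda>n. ereal (M (prefix \<omega> n)))"
        by blast
      show "ereal (V N [] - (1/2) ^ (2 * N + 2)) \<le> x" using V_le[OF M(2,3)] M(1) by simp
    qed
    also have "\<dots> \<le> ereal ((1/2) ^ (2 * N + 2))" by (rule prob)
    finally show ?thesis by simp
  qed
  then have "real (v N 1) / 2 ^ J N \<le> (1/2) ^ (2 * N + 1)" for N
    unfolding V_def by simp
  moreover have "v N (beta s) = 2 ^ J N"
    if "B N \<le> length s" "i \<le> length s" "D N (take i s)" for N s i
    using that V_leaf[of N s] unfolding hit_def by auto
  moreover have "N \<le> J N" for N by (simp add: J_def)
  ultimately show thesis using that[OF v J] sm unfolding V_def by blast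
qed

lemma nondegenerate_growth_bound:
  assumes \<phi>: "forecasting_system \<phi>" "non_degenerate \<phi>" "computable_fc \<phi>"
  obtains K where "trec K"
    and "\<And>M s. supermartingale \<phi> M \<Longrightarrow> (\<And>t. 0 \<le> M t) \<Longrightarrow> M s \<le> 2 ^ K (beta s) * M []"
proof -
  obtain Ql Qh where Ql: "trec (\<lambda>z. Ql (pfst z) (psnd z))"
    "\<And>b J. real (Ql b J) \<le> 2 ^ J * lower_fc \<phi> (str_of b) + 1"
    "\<And>b J. 2 ^ J * lower_fc \<phi> (str_of b) \<le> real (Ql b J) + 2"
    and Qh: "trec (\<lambda>z. Qh (pfst z) (psnd z))"
    "\<And>b J. real (Qh b J) \<le> 2 ^ J * upper_fc \<phi> (str_of b) + 1"
    "\<And>b J. 2 ^ J * upper_fc \<phi> (str_of b) \<le> real (Qh b J) + 2"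
    using computable_fc_approx[OF \<phi>(1,3)] by blast
  \<comment> \<open>With slack 1 above and 2 below, these inequalities certify that
    \<open>2 ^ j\<close> times the upper forecast, and times one minus the lower forecast, are at
    least 1. Both hold once these products exceed 4.\<close>
  define m where "m b = (LEAST j. 2 \<le> Qh b j \<and> Ql b j + 3 \<le> 2 ^ j)" for b
  have ex: "\<exists>j. 2 \<le> Qh b j \<and> Ql b j + 3 \<le> 2 ^ j" for b
  proof -
    let ?l = "lower_fc \<phi> (str_of b)" and ?u = "upper_fc \<phi> (str_of b)"
    define x where "x = min ?u (1 - ?l)"
    have x: "0 < x" "x \<le> ?u" "x \<le> 1 - ?l"
      using \<phi>(2) unfolding non_degenerate_def x_def by auto
    obtain j where "4 / x < 2 ^ j" using real_arch_pow[of 2 "4 / x"] by auto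
    then have j: "4 < 2 ^ j * x" using x(1) by (simp add: divide_less_eq)
    have "2 ^ j * x \<le> 2 ^ j * ?u" "2 ^ j * x \<le> 2 ^ j * (1 - ?l)"
      using x by (intro mult_left_mono; simp)+
    then have "4 < 2 ^ j * ?u" "2 ^ j * ?l + 4 < 2 ^ j" using j unfolding right_diff_distrib by linarith+
    then have "real 2 \<le> real (Qh b j)" "real (Ql b j + 3) \<le> real (2 ^ j)"
      using Qh(3)[where b = b and J = j] Ql(2)[where b = b and J = j] by auto
    then show ?thesis unfolding of_nat_le_iff by blast
  qed
  have m: "2 \<le> Qh b (m b)" "Ql b (m b) + 3 \<le> 2 ^ m b" for b
    using LeastI_ex[OF ex[of b]] unfolding m_def by auto
  have trec_m: "trec m"
    unfolding m_def using ex
    by (intro trec_Least trec_intros trec_comp2[OF Ql(1)] trec_comp2[OF Qh(1)])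
  \<comment> \<open>Proper prefixes have smaller numbers, so the sum over all smaller numbers
    majorises the sum along the branch.\<close>
  have "trec (\<lambda>b. \<Sum>c<b. m c)"
    by (intro trec_sum trec_intros trec_comp[OF trec_m])
  moreover have "M s \<le> 2 ^ (\<Sum>c<beta s. m c) * M []"
    if M: "supermartingale \<phi> M" "\<And>t. 0 \<le> M t" for M s
  proof (induction s rule: rev_induct)
    case Nil
    show ?case using M(2)[of "[]"] by (simp add: mult_right_mono[of 1 "2 ^ m 0" "M []", simplified])
  next
    case (snoc x s)
    let ?b = "beta s" and ?l = "lower_fc \<phi> s" and ?u = "upper_fc \<phi> s"
    have "real (Ql ?b (m ?b) + 3) \<le> real (2 ^ m ?b)" "real 2 \<le> real (Qh ?b (m ?b))"
      using m[of ?b] by (simp_all only: of_nat_le_iff)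
    then have lu: "1 \<le> 2 ^ m ?b * ?u" "1 \<le> 2 ^ m ?b * (1 - ?l)"
      using Ql(3)[where b = ?b and J = "m ?b"] Qh(2)[where b = ?b and J = "m ?b"]
      by (auto simp: algebra_simps)
    have I: "0 \<le> ?l" "?l \<le> 1" "0 \<le> ?u" "?u \<le> 1"
      using forecast_interval[OF \<phi>(1), of s] by auto
    have up: "?u * M (s @ [True]) + (1 - ?u) * M (s @ [False]) \<le> M s"
      and low: "?l * M (s @ [True]) + (1 - ?l) * M (s @ [False]) \<le> M s"
      using M(1) unfolding supermartingale_iff[OF \<phi>(1)] by blast+
    have "M (s @ [x]) \<le> 2 ^ m ?b * M s"
    proof (cases x)
      case True
      have "M (s @ [True]) \<le> (2 ^ m ?b * ?u) * M (s @ [True])"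
        using mult_right_mono[OF lu(1) M(2)] by simp
      also have "\<dots> = 2 ^ m ?b * (?u * M (s @ [True]))" by simp
      also have "\<dots> \<le> 2 ^ m ?b * M s"
        using up mult_nonneg_nonneg[of "1 - ?u", OF _ M(2)[of "s @ [False]"]] I
        by (intro mult_left_mono) auto
      finally show ?thesis using True by simp
    next
      case False
      have "M (s @ [False]) \<le> (2 ^ m ?b * (1 - ?l)) * M (s @ [False])"
        using mult_right_mono[OF lu(2) M(2)] by simp
      also have "\<dots> = 2 ^ m ?b * ((1 - ?l) * M (s @ [False]))" by simp
      also have "\<dots> \<le> 2 ^ m ?b * M s"
        using low mult_nonneg_nonneg[of ?l, OF _ M(2)[of "s @ [True]"]] I
        by (intro mult_left_mono) auto
      finally show ?thesis using False by simp
    qed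
    also have "\<dots> \<le> 2 ^ m ?b * (2 ^ (\<Sum>c<?b. m c) * M [])"
      using snoc by (intro mult_left_mono) auto
    also have "\<dots> = 2 ^ (\<Sum>c<Suc ?b. m c) * M []" by (simp add: power_add)
    also have "\<dots> \<le> 2 ^ (\<Sum>c<beta (s @ [x]). m c) * M []"
    proof (intro mult_right_mono power_increasing sum_mono2)
      have "Suc ?b \<le> beta (s @ [x])" using beta_pos[of s] unfolding beta_snoc by linarith
      then show "{..<Suc ?b} \<subseteq> {..<beta (s @ [x])}" by auto
    qed (use M(2) in auto)
    finally show ?case .
  qed
  ultimately show thesis using that by blast
qed

text \<open>Beyond a computable length a level has small upper probability. Cutting it at such
  lengths yields finite sets of situations, small enough to be given growing weights, and a path in
  the level passes through one of them.\<close>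

lemma schnorr_test_shells:
  assumes A: "schnorr_test \<phi> A"
  obtains B D where "trec B" and "dec (\<lambda>z. D (pfst z) (str_of (psnd z)))"
    and "\<And>N t. D N t \<Longrightarrow> length t < B N" and "\<And>N. N < B N"
    and "\<And>N. upper_prob \<phi> (cylset {t. D N t}) \<le> ereal ((1/2) ^ (2 * N + 2))"
    and "\<And>\<omega> n. \<omega> \<in> (\<Inter>n. cylset (level A n)) \<Longrightarrow> \<exists>N\<ge>n. \<omega> \<in> cylset {t. D N t}"
proof -
  obtain e where rec: "recursive_set (enc_pair enc_nat enc_str) A"
    and prob: "\<And>n. upper_prob \<phi> (cylset (level A n)) \<le> ereal ((1/2) ^ n)"
    and e: "recursive_map (enc_pair enc_nat enc_nat) enc_nat e"
    and tail: "\<And>N n l. e (N, n) \<le> l \<Longrightarrow>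
      upper_prob \<phi> (cylset (level A n) - cylset (level_below A n l)) \<le> ereal ((1/2) ^ N)"
    using A unfolding schnorr_test_def by blast
  have e': "trec (\<lambda>x. e (f x, g x))" if "trec f" "trec g" for f g
    using trec_recursive_map[OF e, of "\<lambda>x. (f x, g x)"] that
    by (simp add: enc_pair_def enc_nat_def trec_prod_encode)
  \<comment> \<open>\<open>N\<close> codes the \<open>k\<close>-th shell of the level \<open>lv N\<close>. For \<open>k = 0\<close> the level is \<open>2 * N + 2\<close>, so its
    own probability bound suffices; for \<open>k > 0\<close> the tail bound is asked for precision \<open>2 * N + 2\<close>.\<close>
  define lv where "lv N = 2 * prod_encode (pfst N, 0) + 2" for N
  define a where "a N = (if psnd N = 0 then 0 else e (2 * N + 2, lv N))" for N
  \<comment> \<open>A shell ends no earlier than the next one of the same level begins, so there are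
    no gaps. The summand \<open>N + 1\<close> makes the shells of a level reach every
    length.\<close>
  define B where "B N = a (prod_encode (pfst N, Suc (psnd N))) + N + 1" for N
  define early where "early N t \<longleftrightarrow> (lv N, t) \<in> A \<and> length t < a N" for N t
  \<comment> \<open>The last condition removes whole cylinders of short members, because the tail
    bound speaks of a difference of sets of paths.\<close>
  define D where "D N t \<longleftrightarrow> (lv N, t) \<in> A \<and> length t < B N \<and> \<not> (\<exists>i\<le>length t. early N (take i t))" for N t
  have lv: "trec (\<lambda>x. lv (f x))" if "trec f" for f
    unfolding lv_def by (intro trec_intros that)
  have a: "trec (\<lambda>x. a (f x))" if "trec f" for f
    unfolding a_def by (intro trec_intros e' lv that)
  have B: "trec B" unfolding B_def by (intro trec_intros a)
  have "dec (\<lambda>z. early (pfst z) (str_of (psnd z)))"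
    unfolding early_def by (intro trec_intros dec_recursive_set[OF rec] lv a trec_length_str_of)
  then have "dec (\<lambda>z. D (pfst z) (str_of (psnd z)))"
    unfolding D_def by (intro trec_intros dec_recursive_set[OF rec] lv dec_ex_prefix
        trec_comp[OF B] trec_length_str_of)
  moreover have "upper_prob \<phi> (cylset {t. D N t}) \<le> ereal ((1/2) ^ (2 * N + 2))" for N
  proof -
    have sub: "cylset {t. D N t} \<subseteq> cylset (level A (lv N)) - cylset (level_below A (lv N) (a N))"
    proof
      fix \<omega> assume "\<omega> \<in> cylset {t. D N t}"
      then obtain t where t: "D N t" "prefix \<omega> (length t) = t" unfolding cylset_def cyl_def by auto
      have "\<omega> \<in> cylset (level A (lv N))"
        using t unfolding cylset_def cyl_def level_def D_def by auto
      \<comment> \<open>A short member \<open>u\<close> on the path is either an early prefix of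
        \<open>t\<close>, or longer than \<open>t\<close>, and then \<open>t\<close> itself is
        early.\<close>
      moreover have False if below: "\<omega> \<in> cylset (level_below A (lv N) (a N))"
      proof -
        obtain u where u: "(lv N, u) \<in> A" "length u < a N" "prefix \<omega> (length u) = u"
          using below unfolding cylset_def cyl_def level_below_def level_def by auto
        show False
        proof (cases "length u \<le> length t")
          case True
          then have "take (length u) t = u" using take_prefix[of "length u" "length t" \<omega>] t u by simp
          then show False using t(1) u True unfolding D_def early_def by auto
        next
          case False
          then have "early N (take (length t) t)" using t(1) u unfolding D_def early_def by auto
          then show False using t(1) unfolding D_def by blast
        qed
      qed
      ultimately show "\<omega> \<in> cylset (level A (lv N)) - cylset (level_below A (lv N) (a N))" by blast
    qed
    show ?thesis
    proof (cases "psnd N = 0")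
      case True
      then have "lv N = 2 * N + 2" unfolding lv_def using prod_encode_pfst_psnd[of N] by simp
      then have "upper_prob \<phi> (cylset (level A (lv N))) \<le> ereal ((1/2) ^ (2 * N + 2))"
        using prob[of "lv N"] by simp
      moreover have "upper_prob \<phi> (cylset {t. D N t}) \<le> upper_prob \<phi> (cylset (level A (lv N)))"
        using sub by (intro upper_prob_mono) blast
      ultimately show ?thesis by (rule order_trans[rotated])
    next
      case False
      then have "e (2 * N + 2, lv N) \<le> a N" by (simp add: a_def)
      then show ?thesis by (rule order_trans[OF upper_prob_mono[OF sub] tail])
    qed
  qed
  moreover have "\<exists>N\<ge>n. \<omega> \<in> cylset {t. D N t}"
    if \<omega>: "\<omega> \<in> (\<Inter>n. cylset (level A n))" for \<omega> n
  proof -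
    \<comment> \<open>The shells of this level have codes
      \<open>prod_encode (n, k) \<ge> n\<close>.\<close>
    define l where "l = 2 * prod_encode (n, 0) + 2"
    define m where "m = (LEAST m. (l, prefix \<omega> m) \<in> A)"
    have "\<exists>m. (l, prefix \<omega> m) \<in> A"
      using \<omega> unfolding cylset_def cyl_def level_def by (metis (mono_tags, lifting) INT_D UNIV_I UN_E mem_Collect_eq)
    then have mA: "(l, prefix \<omega> m) \<in> A" unfolding m_def by (rule LeastI_ex)
    have m_min: "(l, prefix \<omega> i) \<notin> A" if "i < m" for i
      using that unfolding m_def by (rule not_less_Least)
    \<comment> \<open>The first shell reaching length \<open>m\<close>. Minimality of
      \<open>k\<close> gives \<open>a ?N \<le> m\<close>, and minimality of \<open>m\<close>
      excludes early prefixes.\<close>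
    define k where "k = (LEAST k. m < B (prod_encode (n, k)))"
    have "m < B (prod_encode (n, m))" using le_prod_encode_2[of m n] by (simp add: B_def)
    then have k: "m < B (prod_encode (n, k))" unfolding k_def by (rule LeastI)
    let ?N = "prod_encode (n, k)"
    have "a ?N \<le> m"
    proof (cases k)
      case 0
      then show ?thesis by (simp add: a_def)
    next
      case (Suc k')
      then have "\<not> m < B (prod_encode (n, k'))" unfolding k_def by (intro not_less_Least) simp
      then show ?thesis unfolding Suc by (simp add: B_def)
    qed
    moreover have "lv ?N = l" by (simp add: lv_def l_def)
    ultimately have "D ?N (prefix \<omega> m)"
      using mA m_min k unfolding D_def early_def by (auto simp: take_prefix)
    then have "\<omega> \<in> cylset {t. D ?N t}" unfolding cylset_def cyl_def by (intro UN_I[of "prefix \<omega> m"]) auto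
    moreover have "n \<le> ?N" by (rule le_prod_encode_1)
    ultimately show ?thesis by blast
  qed
  ultimately show thesis using that[of B D] B by (auto simp: D_def B_def)
qed

text \<open>The weighted prices at the root are at most 2^-(N+1). The growth bound carries this
  geometric decay to every situation, up to a computable factor, which gives both convergence and a
  computable tail.\<close>

lemma weighted_sum_test_supermartingale:
  assumes \<phi>: "forecasting_system \<phi>" "non_degenerate \<phi>" "computable_fc \<phi>"
    and v: "trec (\<lambda>z. v (pfst z) (psnd z))" and J: "trec J" "\<And>N. N \<le> J N"
    and sm: "\<And>N. supermartingale \<phi> (\<lambda>s. real (v N (beta s)) / 2 ^ J N)"
    and root: "\<And>N. real (v N 1) / 2 ^ J N \<le> (1/2) ^ (2 * N + 1)"
  obtains T where "test_supermartingale \<phi> T" and "computable_real_map enc_str T"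
    and "\<And>N s. s \<noteq> [] \<Longrightarrow> 2 ^ N * (real (v N (beta s)) / 2 ^ J N) \<le> T s"
proof -
  obtain K where K: "trec K" and growth: "\<And>M s. supermartingale \<phi> M \<Longrightarrow> (\<And>t. 0 \<le> M t) \<Longrightarrow>
      M s \<le> 2 ^ K (beta s) * M []"
    using nondegenerate_growth_bound[OF \<phi>] by blast
  define F where "F s N = 2 ^ N * (real (v N (beta s)) / 2 ^ J N)" for s N
  have F_nonneg: "0 \<le> F s N" for s N by (simp add: F_def)
  have F_le_root: "F [] N \<le> (1/2) ^ Suc N" for N
  proof -
    have "F [] N \<le> 2 ^ N * (1/2) ^ (2 * N + 1)"
      unfolding F_def using root[of N] by (intro mult_left_mono) simp_all
    also have "2 * N + 1 = N + Suc N" by simp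
    also have "2 ^ N * (1/2) ^ (N + Suc N) = (1/2 :: real) ^ Suc N"
      unfolding power_add by (simp add: power_one_over)
    finally show ?thesis .
  qed
  have F_le: "F s N \<le> 2 ^ K (beta s) * (1/2) ^ Suc N" for s N
  proof -
    have "F s N \<le> 2 ^ N * (2 ^ K (beta s) * (real (v N 1) / 2 ^ J N))"
      unfolding F_def using growth[OF sm[of N], of s] by (intro mult_left_mono) simp_all
    also have "\<dots> = 2 ^ K (beta s) * F [] N" by (simp add: F_def)
    also have "\<dots> \<le> 2 ^ K (beta s) * (1/2) ^ Suc N" using F_le_root by (intro mult_left_mono) auto
    finally show ?thesis .
  qed
  have geo: "(\<lambda>N. c * (1/2) ^ Suc N) sums c" for c :: real
    using sums_mult[OF power_half_series, of c] by simp
  have F_summable: "summable (F s)" for s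
    by (rule summable_comparison_test'[OF sums_summable[OF geo[of "2 ^ K (beta s)"]], of 0])
      (use F_le F_nonneg in auto)
  \<comment> \<open>The sum at the root may be below 1. Raising only that value keeps the
    supermartingale inequalities.\<close>
  define T where "T s = (if s = [] then 1 else suminf (F s))" for s
  have sum_root: "suminf (F []) \<le> 1"
    using suminf_le[OF F_le_root F_summable[of "[]"]] power_half_series sums_unique sums_summable
    by metis
  have T_ge: "suminf (F s) \<le> T s" for s using sum_root by (simp add: T_def)
  have "supermartingale \<phi> T"
    unfolding supermartingale_iff[OF \<phi>(1)]
  proof (intro allI ballI)
    fix s p assume p: "p \<in> {lower_fc \<phi> s, upper_fc \<phi> s}"
    have F_super: "p * F (s @ [True]) N + (1 - p) * F (s @ [False]) N \<le> F s N" for N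
    proof -
      let ?V = "\<lambda>s. real (v N (beta s)) / 2 ^ J N"
      have "p * ?V (s @ [True]) + (1 - p) * ?V (s @ [False]) \<le> ?V s"
        using sm[of N] p unfolding supermartingale_iff[OF \<phi>(1)] by blast
      then have "2 ^ N * (p * ?V (s @ [True]) + (1 - p) * ?V (s @ [False])) \<le> 2 ^ N * ?V s"
        by (rule mult_left_mono) simp
      then show ?thesis unfolding F_def distrib_left by (simp add: mult.left_commute)
    qed
    have "p * T (s @ [True]) + (1 - p) * T (s @ [False]) =
        p * suminf (F (s @ [True])) + (1 - p) * suminf (F (s @ [False]))"
      by (simp add: T_def)
    also have "\<dots> = (\<Sum>N. p * F (s @ [True]) N + (1 - p) * F (s @ [False]) N)"
      by (simp add: suminf_add[symmetric] suminf_mult summable_mult F_summable)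
    also have "\<dots> \<le> suminf (F s)"
      using F_super by (intro suminf_le summable_add summable_mult F_summable) auto
    also have "\<dots> \<le> T s" by (rule T_ge)
    finally show "p * T (s @ [True]) + (1 - p) * T (s @ [False]) \<le> T s" .
  qed
  moreover have "0 \<le> T s" for s
    unfolding T_def by (simp add: suminf_nonneg[OF F_summable F_nonneg])
  ultimately have "test_supermartingale \<phi> T"
    unfolding test_supermartingale_def by (simp add: T_def)
  moreover have "computable_real_map enc_str T"
  proof -
    \<comment> \<open>The tail from index \<open>R\<close> on is at most 2^(K - R) =
      2^-(M+2).\<close>
    define R where "R b M = K b + M + 2" for b M
    \<comment> \<open>The sum is a common exponent for all terms kept. It is also at least
      \<open>J M \<ge> M\<close>, so the half unit added for odd numerators stays within the
      error.\<close>
    define E where "E b M = (if b = 1 then M else \<Sum>N<R b M. J N)" for b M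
    define X where "X b M = (if b = 1 then 2 ^ M
      else \<Sum>N<R b M. 2 ^ N * v N b * 2 ^ ((\<Sum>N<R b M. J N) - J N))" for b M :: nat
    have sum_J: "trec (\<lambda>x. \<Sum>N<R (f x) (g x). J N)" if "trec f" "trec g" for f g
      unfolding R_def by (intro trec_sum trec_intros trec_comp[OF J(1)] trec_comp[OF K] that)
    show ?thesis
    proof (rule computable_real_map_dyadicI[of X E])
      show "trec (\<lambda>z. E (pfst z) (psnd z))"
        unfolding E_def by (intro trec_intros sum_J)
      show "trec (\<lambda>z. X (pfst z) (psnd z))"
        unfolding X_def
        by (intro trec_intros trec_sum[of "\<lambda>z N. 2 ^ N * v N (pfst z) *
                2 ^ ((\<Sum>N<R (pfst z) (psnd z). J N) - J N)"] sum_J trec_comp2[OF v] trec_comp[OF J(1)])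
          (unfold R_def, intro trec_intros trec_comp[OF K])
      fix s M
      let ?b = "beta s"
      show "\<bar>T s - (2 * real (X ?b M) + 1) / 2 ^ Suc (E ?b M)\<bar> \<le> (1/2) ^ M"
      proof (cases "s = []")
        case True
        then have "(2 * real (X ?b M) + 1) / 2 ^ Suc (E ?b M) = 1 + (1/2) ^ Suc M"
          by (simp add: X_def E_def field_simps power_one_over)
        then show ?thesis using True by (simp add: T_def)
      next
        case False
        have "?b \<noteq> 1" using False by (metis beta_Nil str_of_beta)
        let ?R = "R ?b M" and ?E = "\<Sum>N<R ?b M. J N"
        have XE: "X ?b M = (\<Sum>N<?R. 2 ^ N * v N ?b * 2 ^ (?E - J N))" "E ?b M = ?E"
          using \<open>?b \<noteq> 1\<close> by (simp_all add: X_def E_def)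
        have "real (X ?b M) = 2 ^ ?E * (\<Sum>N<?R. F s N)"
        proof -
          have "real (2 ^ N * v N ?b * 2 ^ (?E - J N)) = 2 ^ ?E * F s N" if "N < ?R" for N
          proof -
            have "J N \<le> ?E" using that by (intro member_le_sum) auto
            then have "(2 :: real) ^ ?E = 2 ^ (?E - J N) * 2 ^ J N" by (simp flip: power_add)
            then show ?thesis by (simp add: F_def)
          qed
          then show ?thesis unfolding XE by (simp add: sum_distrib_left)
        qed
        then have q: "(2 * real (X ?b M) + 1) / 2 ^ Suc (E ?b M) = (\<Sum>N<?R. F s N) + (1/2) ^ Suc ?E"
          unfolding XE(2) by (simp add: field_simps power_one_over)
        have "T s = (\<Sum>N. F s (N + ?R)) + (\<Sum>N<?R. F s N)"
          using False suminf_split_initial_segment[OF F_summable, of s ?R] by (simp add: T_def)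
        moreover have "0 \<le> (\<Sum>N. F s (N + ?R))"
          using F_summable F_nonneg by (intro suminf_nonneg) (auto simp: summable_iff_shift)
        moreover have "(\<Sum>N. F s (N + ?R)) \<le> (1/2) ^ M"
        proof -
          have half: "2 ^ K ?b * (1/2) ^ ?R = (1/2 :: real) ^ (M + 2)"
            by (simp add: R_def power_add power_one_over)
          have "F s (N + ?R) \<le> (1/2) ^ (M + 2) * (1/2) ^ Suc N" for N
          proof -
            have "F s (N + ?R) \<le> 2 ^ K ?b * (1/2) ^ Suc (N + ?R)" by (rule F_le)
            also have "\<dots> = (2 ^ K ?b * (1/2) ^ ?R) * (1/2) ^ Suc N"
              by (simp add: power_add)
            finally show ?thesis unfolding half .
          qed
          then have "(\<Sum>N. F s (N + ?R)) \<le> (\<Sum>N. (1/2) ^ (M + 2) * (1/2) ^ Suc N)"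
            using F_summable[of s] geo[THEN sums_summable]
            by (intro suminf_le) (auto simp: summable_iff_shift)
          also have "\<dots> = (1/2) ^ (M + 2)" using geo by (rule sums_unique[symmetric])
          also have "\<dots> \<le> (1/2) ^ M" by (rule power_decreasing) auto
          finally show ?thesis .
        qed
        moreover have "(1/2 :: real) ^ Suc ?E \<le> (1/2) ^ M"
        proof (rule power_decreasing)
          have "M \<le> J M" by (rule J(2))
          also have "\<dots> \<le> ?E" by (intro member_le_sum) (auto simp: R_def)
          finally show "M \<le> Suc ?E" by simp
        qed auto
        moreover have "0 \<le> (1/2 :: real) ^ Suc ?E" by simp
        ultimately show ?thesis unfolding q by linarith
      qed
    qed
  qed
  moreover have "2 ^ N * (real (v N (beta s)) / 2 ^ J N) \<le> T s" if "s \<noteq> []" for N s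
  proof -
    have "F s N = sum (F s) {N}" by simp
    also have "\<dots> \<le> suminf (F s)"
      by (rule sum_le_suminf[OF F_summable]) (use F_nonneg in auto)
    finally show ?thesis using that by (simp add: T_def F_def)
  qed
  ultimately show thesis using that by blast
qed

lemma schnorr_random_imp_schnorr_test_random:
  assumes \<phi>: "forecasting_system \<phi>" "non_degenerate \<phi>" "computable_fc \<phi>"
    and random: "schnorr_random \<phi> \<omega>"
  shows "schnorr_test_random \<phi> \<omega>"
  unfolding schnorr_test_random_def
proof (intro allI impI notI)
  fix A assume A: "schnorr_test \<phi> A" and \<omega>: "\<omega> \<in> (\<Inter>n. cylset (level A n))"
  obtain B D where B: "trec B"
    and D: "dec (\<lambda>z. D (pfst z) (str_of (psnd z)))" "\<And>N t. D N t \<Longrightarrow> length t < B N"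
    and B_gt: "\<And>N. N < B N"
    and prob: "\<And>N. upper_prob \<phi> (cylset {t. D N t}) \<le> ereal ((1/2) ^ (2 * N + 2))"
    and shells: "\<And>\<omega> n. \<omega> \<in> (\<Inter>n. cylset (level A n)) \<Longrightarrow> \<exists>N\<ge>n. \<omega> \<in> cylset {t. D N t}"
    by (rule schnorr_test_shells[OF A], rule that; assumption)
  obtain v J where v: "trec (\<lambda>z. v (pfst z) (psnd z))" "trec J" "\<And>N. N \<le> J N"
    "\<And>N. supermartingale \<phi> (\<lambda>s. real (v N (beta s)) / 2 ^ J N)"
    "\<And>N. real (v N 1) / 2 ^ J N \<le> (1/2) ^ (2 * N + 1)"
    and hit: "\<And>N s i. B N \<le> length s \<Longrightarrow> i \<le> length s \<Longrightarrow> D N (take i s) \<Longrightarrow> v N (beta s) = 2 ^ J N"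
    using clopen_supermartingales[of \<phi> B D, OF \<phi>(1,3) B D(1) _ prob] D(2) by blast
  obtain T where T: "test_supermartingale \<phi> T" "computable_real_map enc_str T"
    and T_ge: "\<And>N s. s \<noteq> [] \<Longrightarrow> 2 ^ N * (real (v N (beta s)) / 2 ^ J N) \<le> T s"
    using weighted_sum_test_supermartingale[where v = v, OF \<phi> v] by blast
  \<comment> \<open>A monotone majorant of \<open>B\<close>; its inverse \<open>\<rho>\<close>
    satisfies \<open>\<rho> (B N) \<le> N\<close>.\<close>
  define L where "L j = (\<Sum>i<Suc j. B i)" for j
  define \<rho> where "\<rho> m = (LEAST j. m \<le> L j)" for m
  have B_le_L: "B j \<le> L j" for j unfolding L_def by (intro member_le_sum) auto
  have ex: "\<exists>j. m \<le> L j" for m using B_gt[of m] B_le_L[of m] by (intro exI[of _ m]) simp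
  have \<rho>: "m \<le> L (\<rho> m)" for m unfolding \<rho>_def using ex by (rule LeastI_ex)
  have \<rho>_le: "\<rho> m \<le> j" if "m \<le> L j" for m j unfolding \<rho>_def using that by (rule Least_le)
  have "growth_function \<rho>"
    unfolding growth_function_def
  proof (intro conjI allI)
    have "trec \<rho>"
      unfolding \<rho>_def L_def using ex[unfolded L_def]
      by (intro trec_Least trec_sum trec_intros trec_comp[OF B])
    then show "recursive_map enc_nat enc_nat \<rho>"
      unfolding trec_def recursive_map_def enc_nat_def .
    show "mono \<rho>"
      using \<rho> by (intro monoI \<rho>_le) (meson order_trans)
    show "\<exists>n. m \<le> \<rho> n" for m
    proof (rule exI, rule ccontr)
      assume "\<not> m \<le> \<rho> (Suc (L m))"
      then have "L (\<rho> (Suc (L m))) \<le> L m" unfolding L_def by (intro sum_mono2) auto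
      then show False using \<rho>[of "Suc (L m)"] by linarith
    qed
  qed
  then have "limsup (\<lambda>n. ereal (T (prefix \<omega> n) - real (\<rho> n))) \<le> 0"
    using random T unfolding schnorr_random_def by blast
  also have "(0 :: ereal) < 1" by simp
  finally have "\<forall>\<^sub>F n in sequentially. ereal (T (prefix \<omega> n) - real (\<rho> n)) < 1"
    by (rule Limsup_lessD)
  then obtain n where n: "\<And>m. n \<le> m \<Longrightarrow> T (prefix \<omega> m) - real (\<rho> m) < 1"
    unfolding eventually_sequentially by auto
  obtain N t where N: "n \<le> N" "D N t" "prefix \<omega> (length t) = t"
    using shells[OF \<omega>, of n] unfolding cylset_def cyl_def by auto
  \<comment> \<open>At depth \<open>B N\<close> the recursion has its leaves, so the price of the
    shell containing the path equals 1 there.\<close>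
  let ?s = "prefix \<omega> (B N)"
  have "length t < B N" by (rule D(2)[OF N(2)])
  then have "v N (beta ?s) = 2 ^ J N"
    using N(2,3) by (intro hit[of N ?s "length t"]) (simp_all add: take_prefix)
  moreover have "?s \<noteq> []" using B_gt[of N] by (metis length_prefix list.size(3) not_less0)
  ultimately have "2 ^ N \<le> T ?s" using T_ge[of ?s N] by simp
  moreover have "real (\<rho> (B N)) \<le> real N" using \<rho>_le[OF B_le_L] by simp
  moreover have "real N + 1 \<le> 2 ^ N"
    using of_nat_mono[OF Suc_leI[OF less_exp[of N]], where ?'a = real] by simp
  moreover have "T ?s - real (\<rho> (B N)) < 1" using n N(1) B_gt[of N] by simp
  ultimately show False by linarith
qed

theorem theorem8p5:
  fixes \<phi> :: "bool list \<Rightarrow> real set" and \<omega> :: "nat \<Rightarrow> bool"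
  assumes "forecasting_system \<phi>" and "non_degenerate \<phi>" and "computable_fc \<phi>"
  shows "schnorr_random \<phi> \<omega> \<longleftrightarrow> schnorr_test_random \<phi> \<omega>"
  using assms schnorr_random_imp_schnorr_test_random schnorr_test_random_imp_schnorr_random by blast

end
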